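(* In every locally finitely distributive relatively complemented modular lattice, perspectivity is transitive.
   Context: Lattices are not assumed to be bounded. A lattice is relatively complemented if every closed interval $[a,b]$ of it is complemented. For a positive integer $n$, a modular lattice is $n$-distributive if it satisfies the identity $$x\vee\bigwedge_{i\leq n}y_i=\bigwedge_{i\leq n}\Bigl(x\vee\bigwedge_{j\leq n;\ j\neq i}y_j\Bigr)$$ (indices $i,j$ range over $\{0,1,\ldots,n\}$). It is finitely distributive if it is $n$-distributive for some positive integer $n$, and locally finitely distributive if every closed interval of it is finitely distributive. Elements $a,b$ of a lattice $L$ are perspective, $a\sim b$, if there is $x\in L$ with $a\wedge x=b\wedge x$ and $a\vee x=b\vee x$. Perspectivity is transitive in $L$ if $a\sim b$ and $b\sim c$ imply $a\sim c$, for all $a,b,c\in L$. *)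

theory Defs
  imports Main
begin

text \<open>
  Lattices are types of class \<^class>\<open>lattice\<close>, which has no top or bottom element. The predicates
  ending in \<open>_on\<close> are meant for a sublattice \<open>S\<close> (the whole lattice \<^term>\<open>UNIV\<close> or a closed
  interval \<^term>\<open>{a..b}\<close>), whose operations are the restrictions of the ambient ones.
\<close>

definition modular_on :: "'a::lattice set \<Rightarrow> bool" where
  "modular_on S \<longleftrightarrow>
     (\<forall>x\<in>S. \<forall>y\<in>S. \<forall>z\<in>S. x \<le> z \<longrightarrow> sup x (inf y z) = inf (sup x y) z)"

text \<open>
  Only meaningful for \<open>n > 0\<close>: for \<open>n = 0\<close> the inner meet would range over the empty family,
  where \<^const>\<open>Inf_fin\<close> is unspecified.
\<close>

definition n_distributive_on :: "nat \<Rightarrow> 'a::lattice set \<Rightarrow> bool" where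
  "n_distributive_on n S \<longleftrightarrow>
     modular_on S \<and>
     (\<forall>x\<in>S. \<forall>y. (\<forall>i\<le>n. y i \<in> S) \<longrightarrow>
        sup x (Inf_fin (y ` {..n}))
          = Inf_fin ((\<lambda>i. sup x (Inf_fin (y ` ({..n} - {i})))) ` {..n}))"

definition finitely_distributive_on :: "'a::lattice set \<Rightarrow> bool" where
  "finitely_distributive_on S \<longleftrightarrow> (\<exists>n>0. n_distributive_on n S)"

definition locally_finitely_distributive :: "'a::lattice itself \<Rightarrow> bool" where
  "locally_finitely_distributive (_ :: 'a itself) \<longleftrightarrow>
     (\<forall>a b :: 'a. a \<le> b \<longrightarrow> finitely_distributive_on {a..b})"

definition complemented_interval :: "'a::lattice \<Rightarrow> 'a \<Rightarrow> bool" where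
  "complemented_interval a b \<longleftrightarrow>
     (\<forall>x\<in>{a..b}. \<exists>y\<in>{a..b}. inf x y = a \<and> sup x y = b)"

definition relatively_complemented :: "'a::lattice itself \<Rightarrow> bool" where
  "relatively_complemented (_ :: 'a itself) \<longleftrightarrow>
     (\<forall>a b :: 'a. a \<le> b \<longrightarrow> complemented_interval a b)"

definition perspective :: "'a::lattice \<Rightarrow> 'a \<Rightarrow> bool" (infix "\<sim>" 50) where
  "a \<sim> b \<longleftrightarrow> (\<exists>x. inf a x = inf b x \<and> sup a x = sup b x)"

end

theory Submission
  imports Defs
begin

text \<open>
  Let \<open>a \<sim> b \<sim> c\<close>. Everything happens in an interval \<open>[\<beta>, \<tau>]\<close> with \<open>\<beta>\<close> below
  \<open>a\<close>, \<open>b\<close>, \<open>c\<close> and the meets with the two axes. Relative complements allow each axis to be shrunk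
  until it meets the elements it relates in \<open>\<beta>\<close>; this is the relation \<open>persp\<close>. Write
  \<open>g = a \<sqinter> c\<close>, \<open>a = g \<squnion> A\<close> and \<open>c = g \<squnion> C\<close> with independent \<open>g\<close>, \<open>A\<close>, \<open>C\<close>. An axis for \<open>A\<close>
  and \<open>C\<close> also serves \<open>a\<close> and \<open>c\<close>, so suppose that \<open>A\<close> and \<open>C\<close> are not perspective.

  The lattice is cut down to a quotient that behaves like a projective space of finite dimension, where
  perspectivity is equality of ranks. Ideals closed under perspectivity are the kernels of
  congruences, and by Zorn's lemma one of them, \<open>I\<close>, is maximal among those modulo which \<open>A\<close> and \<open>C\<close>
  fail to be perspective. Being perspective modulo \<open>I\<close> glues along central decompositions
  (\<open>persp_mod_glue\<close>): if \<open>e\<close> and its complement \<open>f\<close> are central modulo \<open>I\<close>, then axes found after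
  annihilating \<open>e\<close> and after annihilating \<open>f\<close> combine to one. So maximality makes the quotient
  indecomposable.

  An \<open>n\<close>-distributive lattice has no \<open>n + 1\<close> nonzero independent pairwise perspective elements:
  inside their join one finds the failure of the identity that is known from a hyperplane in general
  position and the coordinate hyperplanes of an \<open>(n + 1)\<close>-dimensional vector space
  (\<open>n_distributive_no_homogeneous\<close>). Hence there is a longest homogeneous sequence modulo \<open>I\<close>.
  Its join is central, because anything outside that is perspective to something inside would prolong
  the sequence (\<open>maximal_homogeneous_central\<close>). By indecomposability this join is everything modulo
  \<open>I\<close>, and the same holds for the sequences below it, so its members are atoms modulo \<open>I\<close>. It
  follows that any two elements outside \<open>I\<close> have perspective parts outside \<open>I\<close> (\<open>all_linked\<close>), and
  that independent sequences have bounded length, i.e. the quotient has finite rank.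

  Now pair off perspective parts of \<open>A\<close> and \<open>C\<close> as long as possible. Of the two remainders one lies in
  \<open>I\<close>. Since rank is invariant under perspectivity, \<open>a\<close> and \<open>c\<close> have the same finite rank, and then
  the other remainder lies in \<open>I\<close> as well (\<open>rank_cancel\<close>). So \<open>A\<close> and \<open>C\<close> are perspective
  modulo \<open>I\<close>, a contradiction.

  The quotient is never formed. Lifting its statements to the lattice costs little, since ``nonzero'' can
  be read as ``not in \<open>I\<close>'' while independence and perspectivity are kept as exact equations.
\<close>

unbundle lattice_syntax

section \<open>Perspectivity over a fixed lower bound\<close>

text \<open>
  The laws hold in the whole lattice: \<open>\<beta>\<close> serves as zero for disjointness and \<open>\<tau>\<close> confines ideals and
  homogeneous sequences, while an axis may reach outside \<open>[\<beta>, \<tau>]\<close>.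
\<close>

locale complemented_modular_interval =
  fixes \<beta> \<tau> :: "'a::lattice"
  assumes bounds: "\<beta> \<le> \<tau>"
    and modular: "\<And>x y z :: 'a. x \<le> z \<Longrightarrow> x \<squnion> (y \<sqinter> z) = (x \<squnion> y) \<sqinter> z"
    and complement: "\<And>a b x :: 'a. a \<le> x \<Longrightarrow> x \<le> b \<Longrightarrow> \<exists>y. a \<le> y \<and> y \<le> b \<and> x \<sqinter> y = a \<and> x \<squnion> y = b"
begin

text \<open>
  The form in which modularity is used most: joining \<open>b\<close> with an element that meets \<open>w\<close> inside \<open>b\<close>
  adds nothing below \<open>w\<close>.
\<close>
lemma meet_join_absorb:
  fixes b c w :: 'a
  assumes "b \<le> w" and "c \<sqinter> w \<le> b"
  shows "w \<sqinter> (b \<squnion> c) = b"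
proof -
  have "b \<squnion> (c \<sqinter> w) = (b \<squnion> c) \<sqinter> w"
    using assms(1) by (rule modular)
  then show ?thesis
    using assms by (simp add: sup_absorb1 inf_commute)
qed

text \<open>
  Independence of three elements, tested for one of them against the join of the other two, passes
  to the other members.
\<close>
lemma disjoint_rotate:
  assumes "a \<sqinter> b = \<beta>" and "c \<sqinter> (a \<squnion> b) = \<beta>"
  shows "a \<sqinter> (b \<squnion> c) = \<beta>"
proof -
  have "\<beta> \<le> b" using assms(1) by (metis inf_le2)
  then have "(a \<squnion> b) \<sqinter> (b \<squnion> c) = b"
    using assms(2) by (intro meet_join_absorb) auto
  then have "a \<sqinter> (b \<squnion> c) = a \<sqinter> b"
    by (metis inf_assoc inf_sup_absorb)
  then show ?thesis using assms(1) by simp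
qed

text \<open>
  Both meets are required to be \<open>\<beta>\<close>, so that \<open>d \<mapsto> (d \<squnion> x) \<sqinter> b\<close> is an isomorphism from \<open>[\<beta>, a]\<close>
  onto \<open>[\<beta>, b]\<close> with inverse \<open>d \<mapsto> (d \<squnion> x) \<sqinter> a\<close>.
\<close>
definition axis :: "'a \<Rightarrow> 'a \<Rightarrow> 'a \<Rightarrow> bool" where
  "axis x a b \<longleftrightarrow> a \<sqinter> x = \<beta> \<and> b \<sqinter> x = \<beta> \<and> a \<squnion> x = b \<squnion> x"

definition persp :: "'a \<Rightarrow> 'a \<Rightarrow> bool" where
  "persp a b \<longleftrightarrow> (\<exists>x. axis x a b)"

lemma axis_sym: "axis x a b \<Longrightarrow> axis x b a"
  by (auto simp: axis_def)

lemma persp_sym: "persp a b \<Longrightarrow> persp b a"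
  by (auto simp: persp_def intro: axis_sym)

lemma axis_persp: "axis x a b \<Longrightarrow> persp a b"
  by (auto simp: persp_def)

lemma axis_lower: "axis x a b \<Longrightarrow> \<beta> \<le> a \<and> \<beta> \<le> b \<and> \<beta> \<le> x"
  unfolding axis_def by (metis inf_le1 inf_le2)

lemma persp_lower: "persp a b \<Longrightarrow> \<beta> \<le> a \<and> \<beta> \<le> b"
  using axis_lower by (auto simp: persp_def)

lemma persp_refl: "\<beta> \<le> a \<Longrightarrow> persp a a"
  unfolding persp_def axis_def by (metis inf_absorb2)

lemma axis_cut:
  assumes "axis x a b"
  shows "axis (x \<sqinter> (a \<squnion> b)) a b"
proof -
  have "a \<squnion> (x \<sqinter> (a \<squnion> b)) = (a \<squnion> x) \<sqinter> (a \<squnion> b)" and "b \<squnion> (x \<sqinter> (a \<squnion> b)) = (b \<squnion> x) \<sqinter> (a \<squnion> b)"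
    by (simp_all add: modular)
  moreover have "a \<sqinter> (x \<sqinter> (a \<squnion> b)) = a \<sqinter> x"
    by (metis inf_commute inf_left_commute inf_sup_absorb)
  moreover have "b \<sqinter> (x \<sqinter> (a \<squnion> b)) = b \<sqinter> x"
    by (metis inf_commute inf_left_commute inf_sup_absorb sup_commute)
  ultimately show ?thesis
    using assms by (simp add: axis_def)
qed

lemma persp_axis_below:
  assumes "persp a b"
  obtains x where "axis x a b" and "x \<le> a \<squnion> b"
  using assms axis_cut unfolding persp_def by (meson inf_le2)

text \<open>
  Projecting \<open>p\<close> along \<open>x\<close> into \<open>y\<close>: a complement \<open>r\<close> of \<open>x \<sqinter> y\<close> in \<open>y\<close> complements \<open>x\<close> in \<open>x \<squnion> y\<close>,
  and \<open>(p \<squnion> x) \<sqinter> r\<close> is the image. All transport of elements along an axis is a case of this.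
\<close>
lemma project:
  assumes "p \<le> x \<squnion> y" and "p \<sqinter> x = \<beta>" and "\<beta> \<le> y"
  obtains s where "s \<le> y" and "axis x p s"
proof -
  have "\<beta> \<le> x" using assms(2) by (metis inf_le2)
  then obtain r where r: "r \<le> y" "(x \<sqinter> y) \<sqinter> r = \<beta>" "(x \<sqinter> y) \<squnion> r = y"
    using complement[of \<beta> "x \<sqinter> y" y] assms(3) by auto
  have xr: "x \<sqinter> r = \<beta>"
    using r(1,2) by (metis inf.absorb2 inf_assoc)
  have "x \<squnion> y = x \<squnion> r"
    using r(3) by (metis sup_assoc sup_inf_absorb)
  then have px: "p \<squnion> x \<le> r \<squnion> x"
    using assms(1) by (simp add: sup_commute)
  define s where "s = (p \<squnion> x) \<sqinter> r"
  have "x \<squnion> (r \<sqinter> (p \<squnion> x)) = (x \<squnion> r) \<sqinter> (p \<squnion> x)"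
    by (simp add: modular)
  then have "p \<squnion> x = s \<squnion> x"
    using px by (simp add: s_def inf_commute sup_commute inf_absorb1 inf_absorb2)
  moreover have "s \<sqinter> x = \<beta>"
  proof (rule order.antisym)
    show "s \<sqinter> x \<le> \<beta>" unfolding s_def xr[symmetric] by (simp add: le_infI1)
    show "\<beta> \<le> s \<sqinter> x"
      using \<open>\<beta> \<le> x\<close> xr unfolding s_def by (metis inf_le2 le_inf_iff le_supI2)
  qed
  moreover have "s \<le> y" using r(1) by (simp add: s_def le_infI2)
  ultimately show ?thesis using that assms(2) by (simp add: axis_def)
qed

lemma transport:
  assumes "axis x a b" and "\<beta> \<le> a'" and "a' \<le> a"
  obtains b' where "b' \<le> b" and "axis x a' b'"
proof (rule project[of a' x b])
  show "a' \<le> x \<squnion> b"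
    using assms unfolding axis_def by (metis order_trans sup_commute sup_ge1)
  show "a' \<sqinter> x = \<beta>"
    using assms axis_lower[OF assms(1)] unfolding axis_def
    by (metis inf_mono le_inf_iff order.antisym order_refl)
  show "\<beta> \<le> b" using axis_lower[OF assms(1)] by simp
qed (use that in auto)

lemma transport_persp:
  assumes "persp a b" and "\<beta> \<le> a'" and "a' \<le> a"
  obtains b' where "b' \<le> b" and "persp a' b'"
  using assms transport axis_persp unfolding persp_def by metis

lemma transport_join:
  assumes "axis x a b" and "a = a1 \<squnion> a2" and "\<beta> \<le> a1" and "\<beta> \<le> a2"
  obtains b1 b2 where "axis x a1 b1" and "axis x a2 b2" and "b = b1 \<squnion> b2"
proof -
  obtain b1 where b1: "b1 \<le> b" "axis x a1 b1"
    using transport[OF assms(1,3)] assms(2) by auto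
  obtain b2 where b2: "b2 \<le> b" "axis x a2 b2"
    using transport[OF assms(1,4)] assms(2) by auto
  have "b1 \<squnion> b2 \<squnion> x = a1 \<squnion> a2 \<squnion> x"
    using b1(2) b2(2) unfolding axis_def by (metis sup_assoc sup_commute)
  also have "\<dots> = b \<squnion> x"
    using assms(1,2) by (simp add: axis_def)
  finally have *: "b1 \<squnion> b2 \<squnion> x = b \<squnion> x" .
  have "b \<sqinter> (b1 \<squnion> b2 \<squnion> x) = b1 \<squnion> b2"
  proof (rule meet_join_absorb)
    show "b1 \<squnion> b2 \<le> b" using b1 b2 by simp
    have "x \<sqinter> b = \<beta>" using assms(1) by (simp add: axis_def inf_commute)
    then show "x \<sqinter> b \<le> b1 \<squnion> b2" using axis_lower[OF b1(2)] by (simp add: le_supI1)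
  qed
  then have "b = b1 \<squnion> b2" unfolding * by simp
  with b1 b2 that show ?thesis by blast
qed

text \<open>
  Transport along an axis preserves meets: \<open>(a1 \<squnion> x) \<sqinter> (a2 \<squnion> x)\<close> is \<open>x\<close> joined with
  \<open>a1 \<sqinter> a2\<close>, hence equal to \<open>x\<close> here.
\<close>
lemma transport_disjoint:
  assumes "axis x a b" and "a1 \<le> a" and "a2 \<le> a" and "a1 \<sqinter> a2 = \<beta>"
    and "axis x a1 b1" and "axis x a2 b2" and "b1 \<le> b" and "b2 \<le> b"
  shows "b1 \<sqinter> b2 = \<beta>"
proof (rule order.antisym)
  have low: "\<beta> \<le> a2" "\<beta> \<le> x" using axis_lower[OF assms(6)] by auto
  have "x \<sqinter> a \<le> a2" using assms(1) low unfolding axis_def by (simp add: inf_commute)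
  then have "a \<sqinter> (a2 \<squnion> x) = a2"
    using assms(3) by (intro meet_join_absorb)
  then have a12: "a1 \<sqinter> (a2 \<squnion> x) = \<beta>"
    using assms(2,4) by (metis inf.absorb1 inf_assoc)
  have "b1 \<sqinter> b2 \<le> (a1 \<squnion> x) \<sqinter> (a2 \<squnion> x)"
    using assms(5,6) unfolding axis_def by (metis inf_mono sup_ge1)
  also have "\<dots> = x \<squnion> (a1 \<sqinter> (a2 \<squnion> x))"
    by (simp add: modular sup_commute)
  also have "\<dots> = x" using a12 low by (simp add: sup_absorb1)
  finally have "b1 \<sqinter> b2 \<le> b \<sqinter> x" using assms(7) by (simp add: le_infI1)
  then show "b1 \<sqinter> b2 \<le> \<beta>" using assms(1) unfolding axis_def by metis
  show "\<beta> \<le> b1 \<sqinter> b2" using axis_lower assms(5,6) by auto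
qed

text \<open>
  Von Neumann's case of transitivity. If the axes \<open>x\<close> and \<open>y\<close> are chosen inside \<open>a \<squnion> b\<close> and \<open>b \<squnion> c\<close>,
  which only share \<open>b\<close>, then \<open>y\<close> does not interfere with \<open>x\<close> inside \<open>a \<squnion> b\<close> nor \<open>x\<close> with \<open>y\<close> inside
  \<open>b \<squnion> c\<close>, so \<open>x \<squnion> y\<close> is an axis for \<open>a\<close> and \<open>c\<close>.
\<close>
lemma persp_trans_disjoint:
  assumes "persp a b" and "persp b c" and "c \<sqinter> (a \<squnion> b) = \<beta>"
  shows "persp a c"
proof -
  obtain x where x: "axis x a b" "x \<le> a \<squnion> b" using assms(1) by (rule persp_axis_below)
  obtain y where y: "axis y b c" "y \<le> b \<squnion> c" using assms(2) by (rule persp_axis_below)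
  have low: "\<beta> \<le> b" "\<beta> \<le> x" "\<beta> \<le> y" using axis_lower x y by auto
  have m: "(a \<squnion> b) \<sqinter> (b \<squnion> c) = b"
    using assms(3) low by (intro meet_join_absorb) auto
  have "y \<sqinter> (a \<squnion> b) \<le> x"
  proof -
    have "y \<sqinter> (a \<squnion> b) \<le> (a \<squnion> b) \<sqinter> (b \<squnion> c)" using y(2) by (auto intro: le_infI1)
    then have "y \<sqinter> (a \<squnion> b) \<le> b \<sqinter> y" unfolding m by simp
    then show ?thesis using y(1) low unfolding axis_def by simp
  qed
  then have xy: "(a \<squnion> b) \<sqinter> (x \<squnion> y) = x"
    using x(2) by (intro meet_join_absorb)
  have "x \<sqinter> (b \<squnion> c) \<le> y"
  proof -
    have "x \<sqinter> (b \<squnion> c) \<le> (a \<squnion> b) \<sqinter> (b \<squnion> c)" using x(2) by (auto intro: le_infI1)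
    then have "x \<sqinter> (b \<squnion> c) \<le> b \<sqinter> x" unfolding m by simp
    then show ?thesis using x(1) low unfolding axis_def by simp
  qed
  then have yx: "(b \<squnion> c) \<sqinter> (y \<squnion> x) = y"
    using y(2) by (intro meet_join_absorb)
  have "a \<sqinter> (x \<squnion> y) = a \<sqinter> x"
    by (metis xy inf_assoc inf_sup_absorb)
  moreover have "c \<sqinter> (x \<squnion> y) = c \<sqinter> y"
    by (metis yx inf_assoc inf_sup_absorb sup_commute)
  moreover have "a \<squnion> (x \<squnion> y) = c \<squnion> (x \<squnion> y)"
    using x(1) y(1) unfolding axis_def by (metis sup_assoc sup_commute)
  ultimately have "axis (x \<squnion> y) a c" using x(1) y(1) by (simp add: axis_def)
  then show ?thesis by (rule axis_persp)
qed

text \<open>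
  Meets can be computed componentwise in the join of two disjoint elements as long as each component
  vanishes: replacing \<open>x2\<close> by all of \<open>f\<close> bounds the meet by \<open>p2 \<le> f\<close>, and symmetrically by \<open>e\<close>.
\<close>
lemma disjoint_joins:
  assumes "e \<sqinter> f = \<beta>" and "p1 \<le> e" "x1 \<le> e" "p2 \<le> f" "x2 \<le> f"
    and "p1 \<sqinter> x1 = \<beta>" "p2 \<sqinter> x2 = \<beta>"
  shows "(p1 \<squnion> p2) \<sqinter> (x1 \<squnion> x2) = \<beta>"
proof -
  have low: "\<beta> \<le> p1" "\<beta> \<le> x1" "\<beta> \<le> p2" "\<beta> \<le> x2" using assms(6,7) by (metis inf_le1 inf_le2)+
  have half: "(q1 \<squnion> q2) \<sqinter> (y1 \<squnion> f') \<le> q2"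
    if "e' \<sqinter> f' = \<beta>" "q1 \<le> e'" "y1 \<le> e'" "q2 \<le> f'" "q1 \<sqinter> y1 = \<beta>" "\<beta> \<le> y1" "\<beta> \<le> q2" for e' f' q1 q2 y1
  proof -
    have "e' \<sqinter> (y1 \<squnion> f') = y1"
      using that by (intro meet_join_absorb) (simp_all add: inf_commute)
    then have "q1 \<sqinter> (y1 \<squnion> f') = \<beta>" using that by (metis inf.absorb1 inf_assoc)
    moreover have "q2 \<squnion> (q1 \<sqinter> (y1 \<squnion> f')) = (q2 \<squnion> q1) \<sqinter> (y1 \<squnion> f')"
      using that by (intro modular) (simp add: le_supI2)
    ultimately show ?thesis using that by (simp add: sup_commute sup_absorb1 sup_absorb2)
  qed
  have "(p1 \<squnion> p2) \<sqinter> (x1 \<squnion> f) \<le> p2"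
    using assms low by (intro half) auto
  moreover have "x1 \<squnion> x2 \<le> x1 \<squnion> f" using assms(5) by (simp add: le_supI2)
  ultimately have 1: "(p1 \<squnion> p2) \<sqinter> (x1 \<squnion> x2) \<le> f"
    using assms(4) by (meson inf_mono order_refl order_trans)
  have "(p2 \<squnion> p1) \<sqinter> (x2 \<squnion> e) \<le> p1"
    using assms low by (intro half) (auto simp: inf_commute)
  moreover have "x1 \<squnion> x2 \<le> x2 \<squnion> e" using assms(3) by (simp add: le_supI2)
  ultimately have "(p2 \<squnion> p1) \<sqinter> (x1 \<squnion> x2) \<le> e"
    using assms(2) by (meson inf_mono order_refl order_trans)
  then have 2: "(p1 \<squnion> p2) \<sqinter> (x1 \<squnion> x2) \<le> e"
    by (simp add: sup_commute)
  show ?thesis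
  proof (rule order.antisym)
    show "(p1 \<squnion> p2) \<sqinter> (x1 \<squnion> x2) \<le> \<beta>" using 1 2 assms(1) by (metis le_inf_iff)
    show "\<beta> \<le> (p1 \<squnion> p2) \<sqinter> (x1 \<squnion> x2)" using low by (simp add: le_supI1)
  qed
qed

lemma persp_join:
  assumes "e \<sqinter> f = \<beta>" and "persp p1 q1" "p1 \<le> e" "q1 \<le> e" and "persp p2 q2" "p2 \<le> f" "q2 \<le> f"
  shows "persp (p1 \<squnion> p2) (q1 \<squnion> q2)"
proof -
  obtain x where x: "axis x p1 q1" "x \<le> p1 \<squnion> q1" using assms(2) by (rule persp_axis_below)
  obtain y where y: "axis y p2 q2" "y \<le> p2 \<squnion> q2" using assms(5) by (rule persp_axis_below)
  have le: "x \<le> e" "y \<le> f" using x y assms by (meson le_supI order_trans)+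
  have "(p1 \<squnion> p2) \<sqinter> (x \<squnion> y) = \<beta>" "(q1 \<squnion> q2) \<sqinter> (x \<squnion> y) = \<beta>"
    using x(1) y(1) le assms unfolding axis_def
    by - (rule disjoint_joins[OF assms(1)]; blast)+
  moreover have "p1 \<squnion> p2 \<squnion> (x \<squnion> y) = q1 \<squnion> q2 \<squnion> (x \<squnion> y)"
  proof -
    have "p1 \<squnion> p2 \<squnion> (x \<squnion> y) = (p1 \<squnion> x) \<squnion> (p2 \<squnion> y)" by (simp add: ac_simps)
    also have "\<dots> = (q1 \<squnion> x) \<squnion> (q2 \<squnion> y)" using x(1) y(1) by (simp add: axis_def)
    also have "\<dots> = q1 \<squnion> q2 \<squnion> (x \<squnion> y)" by (simp add: ac_simps)
    finally show ?thesis .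
  qed
  ultimately show ?thesis unfolding persp_def axis_def by blast
qed


section \<open>Neutral ideals and central elements modulo an ideal\<close>

lemma split_by:
  assumes "\<beta> \<le> y" and "\<beta> \<le> w"
  obtains y' where "y' \<le> y" and "\<beta> \<le> y'" and "y' \<sqinter> w = \<beta>" and "(y \<sqinter> w) \<squnion> y' = y"
proof -
  obtain y' where y': "\<beta> \<le> y'" "y' \<le> y" "(y \<sqinter> w) \<sqinter> y' = \<beta>" "(y \<sqinter> w) \<squnion> y' = y"
    using complement[of \<beta> "y \<sqinter> w" y] assms by auto
  have "y' \<sqinter> w = \<beta>"
    using y'(2,3) by (metis inf.absorb2 inf_assoc inf_commute)
  with y' that show ?thesis by blast
qed

lemma disjoint_mono:
  assumes "a \<sqinter> b = \<beta>" and "a' \<le> a" and "b' \<le> b" and "\<beta> \<le> a'" and "\<beta> \<le> b'"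
  shows "a' \<sqinter> b' = \<beta>"
proof (rule order.antisym)
  show "a' \<sqinter> b' \<le> \<beta>" unfolding assms(1)[symmetric] using assms(2,3) by (rule inf_mono)
  show "\<beta> \<le> a' \<sqinter> b'" using assms(4,5) by simp
qed

text \<open>
  In a complemented modular lattice the ideals closed under perspectivity are the kernels of the
  congruences, so membership stands for being zero in a quotient.
\<close>
definition neutral_ideal :: "'a set \<Rightarrow> bool" where
  "neutral_ideal I \<longleftrightarrow>
     I \<subseteq> {\<beta>..\<tau>} \<and> \<beta> \<in> I \<and>
     (\<forall>x\<in>I. \<forall>y. \<beta> \<le> y \<longrightarrow> y \<le> x \<longrightarrow> y \<in> I) \<and>
     (\<forall>x\<in>I. \<forall>y\<in>I. x \<squnion> y \<in> I) \<and>
     (\<forall>x\<in>I. \<forall>y. persp x y \<longrightarrow> y \<le> \<tau> \<longrightarrow> y \<in> I)"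

lemma neutral_idealD:
  assumes "neutral_ideal I"
  shows neutral_bounds: "\<And>x. x \<in> I \<Longrightarrow> \<beta> \<le> x \<and> x \<le> \<tau>"
    and neutral_bot: "\<beta> \<in> I"
    and neutral_down: "\<And>x y. x \<in> I \<Longrightarrow> \<beta> \<le> y \<Longrightarrow> y \<le> x \<Longrightarrow> y \<in> I"
    and neutral_join: "\<And>x y. x \<in> I \<Longrightarrow> y \<in> I \<Longrightarrow> x \<squnion> y \<in> I"
    and neutral_persp: "\<And>x y. x \<in> I \<Longrightarrow> persp x y \<Longrightarrow> y \<le> \<tau> \<Longrightarrow> y \<in> I"
proof -
  have *: "I \<subseteq> {\<beta>..\<tau>}" "\<beta> \<in> I"
    "\<forall>x\<in>I. \<forall>y. \<beta> \<le> y \<longrightarrow> y \<le> x \<longrightarrow> y \<in> I"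
    "\<forall>x\<in>I. \<forall>y\<in>I. x \<squnion> y \<in> I"
    "\<forall>x\<in>I. \<forall>y. persp x y \<longrightarrow> y \<le> \<tau> \<longrightarrow> y \<in> I"
    using assms unfolding neutral_ideal_def by blast+
  show "\<beta> \<le> x \<and> x \<le> \<tau>" if "x \<in> I" for x
    using subsetD[OF *(1) that] by simp
  show "\<beta> \<in> I" by (rule *(2))
  show "y \<in> I" if "x \<in> I" "\<beta> \<le> y" "y \<le> x" for x y using *(3) that by blast
  show "x \<squnion> y \<in> I" if "x \<in> I" "y \<in> I" for x y using *(4) that by blast
  show "y \<in> I" if "x \<in> I" "persp x y" "y \<le> \<tau>" for x y using *(5) that by blast
qed

text \<open>
  The part of \<open>x \<squnion> u\<close> that is disjoint from \<open>x\<close> is perspective, along \<open>x\<close>, to a part of \<open>u\<close>; thus an element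
  below \<open>x\<close> modulo \<open>I\<close> splits into its meet with \<open>x\<close> and an element of \<open>I\<close>.
\<close>
lemma neutral_remainder:
  assumes "neutral_ideal I" and "u \<in> I" and "p \<le> \<tau>" and "p \<le> x \<squnion> u" and "p \<sqinter> x = \<beta>"
  shows "p \<in> I"
proof -
  have "\<beta> \<le> u" using neutral_bounds[OF assms(1,2)] by simp
  then obtain s where s: "s \<le> u" "axis x p s"
    using project[OF assms(4,5)] by blast
  then have "s \<in> I" using neutral_down[OF assms(1,2)] axis_lower by blast
  moreover have "persp s p" using s(2) by (meson axis_persp persp_sym)
  ultimately show ?thesis using assms(3) by (rule neutral_persp[OF assms(1)])
qed

text \<open>
  The ideal generated by \<open>I\<close> and \<open>e\<close>, the kernel obtained by annihilating \<open>e\<close> as well when \<open>e\<close> is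
  central modulo \<open>I\<close>.
\<close>
definition adjoin :: "'a \<Rightarrow> 'a set \<Rightarrow> 'a set" where
  "adjoin e I = {z. \<beta> \<le> z \<and> z \<le> \<tau> \<and> (\<exists>u\<in>I. z \<le> e \<squnion> u)}"

text \<open>
  In the quotient by \<open>I\<close> this says that no nonzero part of \<open>e\<close> is perspective to an element disjoint
  from \<open>e\<close>, which for a complemented modular lattice characterizes the central elements.
\<close>
definition central_mod :: "'a set \<Rightarrow> 'a \<Rightarrow> bool" where
  "central_mod I e \<longleftrightarrow> \<beta> \<le> e \<and> e \<le> \<tau> \<and>
     (\<forall>p q. p \<le> e \<longrightarrow> q \<le> \<tau> \<longrightarrow> e \<sqinter> q = \<beta> \<longrightarrow> persp p q \<longrightarrow> q \<in> I)"

lemma central_modD: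
  assumes "central_mod I e" and "p \<le> e" and "q \<le> \<tau>" and "e \<sqinter> q = \<beta>" and "persp p q"
  shows "q \<in> I"
  using assms unfolding central_mod_def by blast

text \<open>
  Let \<open>z \<le> e \<squnion> u\<close> be perspective to \<open>y\<close>, and let \<open>y'\<close> be the part of \<open>y\<close> outside \<open>e \<squnion> u\<close>. Its
  counterpart in \<open>z\<close> splits into a part below \<open>e\<close> and a part in \<open>I\<close>. Centrality of \<open>e\<close> puts the piece of
  \<open>y'\<close> that corresponds to the former into \<open>I\<close>, so \<open>y' \<in> I\<close>.
\<close>
lemma neutral_ideal_adjoin:
  assumes I: "neutral_ideal I" and e: "central_mod I e"
  shows "neutral_ideal (adjoin e I)"
proof -
  have be: "\<beta> \<le> e" "e \<le> \<tau>" using e by (auto simp: central_mod_def)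
  have closed: "y \<in> adjoin e I" if zy: "z \<in> adjoin e I" "persp z y" "y \<le> \<tau>" for z y
  proof -
    obtain u where u: "u \<in> I" "z \<le> e \<squnion> u" using zy(1) by (auto simp: adjoin_def)
    have y: "\<beta> \<le> y" using persp_lower[OF zy(2)] by simp
    have "\<beta> \<le> e \<squnion> u" using be by (simp add: le_supI1)
    with y obtain y' where y': "y' \<le> y" "\<beta> \<le> y'" "y' \<sqinter> (e \<squnion> u) = \<beta>" "(y \<sqinter> (e \<squnion> u)) \<squnion> y' = y"
      by (rule split_by)
    have "persp y z" using zy(2) by (rule persp_sym)
    then obtain z' where z': "z' \<le> z" "persp y' z'"
      using y'(2,1) by (rule transport_persp)
    then obtain x where x: "axis x z' y'" unfolding persp_def using axis_sym by blast
    have bz': "\<beta> \<le> z'" using persp_lower[OF z'(2)] by simp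
    then obtain z'' where z'': "z'' \<le> z'" "\<beta> \<le> z''" "z'' \<sqinter> e = \<beta>" "(z' \<sqinter> e) \<squnion> z'' = z'"
      using be(1) by (rule split_by)
    obtain q y'' where q: "axis x (z' \<sqinter> e) q" "axis x z'' y''" "y' = q \<squnion> y''"
      using transport_join[OF x z''(4)[symmetric]] bz' be z'' by auto
    have z\<tau>: "z \<le> \<tau>" using zy(1) by (simp add: adjoin_def)
    have "z'' \<in> I"
      using z'' z'(1) u z\<tau> by (intro neutral_remainder[OF I u(1), of z'' e]) auto
    moreover have "y'' \<le> \<tau>" "q \<le> \<tau>" using q(3) y'(1) zy(3) by auto
    ultimately have "y'' \<in> I" using neutral_persp[OF I] q(2) axis_persp by blast
    moreover have "q \<in> I"
    proof (rule central_modD[OF e])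
      show "z' \<sqinter> e \<le> e" by simp
      show "q \<le> \<tau>" by fact
      have "\<beta> \<le> q" using axis_lower[OF q(1)] by simp
      then show "e \<sqinter> q = \<beta>"
        using disjoint_mono[OF y'(3), of q e] q(3) be by (simp add: inf_commute)
      show "persp (z' \<sqinter> e) q" using q(1) by (rule axis_persp)
    qed
    ultimately have y'I: "y' \<in> I" using q(3) neutral_join[OF I] by simp
    have "y \<le> e \<squnion> u \<squnion> y'" using y'(4) by (metis inf_le2 sup_mono order_refl)
    then have "y \<le> e \<squnion> (u \<squnion> y')" by (simp add: sup_assoc)
    moreover have "u \<squnion> y' \<in> I" using u(1) y'I neutral_join[OF I] by simp
    ultimately show ?thesis using y zy(3) by (auto simp: adjoin_def)
  qed
  have "x \<squnion> y \<in> adjoin e I" if xy: "x \<in> adjoin e I" "y \<in> adjoin e I" for x y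
  proof -
    obtain u v where "u \<in> I" "x \<le> e \<squnion> u" "v \<in> I" "y \<le> e \<squnion> v"
      using xy by (auto simp: adjoin_def)
    moreover have "e \<squnion> u \<le> e \<squnion> (u \<squnion> v)" "e \<squnion> v \<le> e \<squnion> (u \<squnion> v)"
      by (simp_all add: le_supI2)
    ultimately have "u \<squnion> v \<in> I" "x \<squnion> y \<le> e \<squnion> (u \<squnion> v)"
      using neutral_join[OF I] by (blast, meson le_supI order_trans)
    then show ?thesis using xy by (auto simp: adjoin_def le_supI1)
  qed
  moreover have "\<beta> \<in> adjoin e I"
    using neutral_bot[OF I] bounds be(1) by (auto simp: adjoin_def intro: le_supI1)
  moreover have "y \<in> adjoin e I" if "x \<in> adjoin e I" "\<beta> \<le> y" "y \<le> x" for x y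
    using that unfolding adjoin_def mem_Collect_eq by (meson order_trans)
  moreover have "adjoin e I \<subseteq> {\<beta>..\<tau>}" by (auto simp: adjoin_def)
  ultimately show ?thesis
    using closed unfolding neutral_ideal_def by blast
qed

lemma adjoin_superset:
  assumes "neutral_ideal I"
  shows "I \<subseteq> adjoin e I"
  using neutral_bounds[OF assms] by (auto simp: adjoin_def intro: le_supI2)

lemma generator_in_adjoin:
  assumes "neutral_ideal I" and "\<beta> \<le> e" and "e \<le> \<tau>"
  shows "e \<in> adjoin e I"
  using neutral_bot[OF assms(1)] assms by (auto simp: adjoin_def)

text \<open>
  An element \<open>q\<close> disjoint from \<open>f\<close> and perspective to a part of \<open>f\<close> is treated in two pieces: \<open>q \<sqinter> e\<close> is
  perspective to something disjoint from \<open>e\<close>, and the part of \<open>q\<close> outside \<open>e\<close> projects along \<open>f\<close> into \<open>e\<close>.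
  Centrality of \<open>e\<close> applies to both.
\<close>
lemma central_mod_complement:
  assumes I: "neutral_ideal I" and e: "central_mod I e" and "e \<sqinter> f = \<beta>" and "e \<squnion> f = \<tau>"
  shows "central_mod I f"
proof -
  have be: "\<beta> \<le> e" "\<beta> \<le> f" "f \<le> \<tau>" using assms(3,4) by (metis inf_le1 inf_le2 sup_ge2)+
  have "q \<in> I" if pq: "p \<le> f" "q \<le> \<tau>" "f \<sqinter> q = \<beta>" "persp p q" for p q
  proof -
    have bq: "\<beta> \<le> q" using persp_lower[OF pq(4)] by simp
    then obtain q' where q': "q' \<le> q" "\<beta> \<le> q'" "q' \<sqinter> e = \<beta>" "(q \<sqinter> e) \<squnion> q' = q"
      using be(1) by (rule split_by)
    obtain p1 where p1: "p1 \<le> p" "persp (q \<sqinter> e) p1"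
      using transport_persp[OF persp_sym[OF pq(4)], of "q \<sqinter> e"] bq be by auto
    have "\<beta> \<le> p1" using persp_lower[OF p1(2)] by simp
    then have "e \<sqinter> p1 = \<beta>" using disjoint_mono[OF assms(3), of e p1] p1(1) pq(1) be by auto
    moreover have "p1 \<le> \<tau>" using p1(1) pq(1) be by auto
    ultimately have "p1 \<in> I"
      using central_modD[OF e _ _ _ p1(2)] by simp
    then have "q \<sqinter> e \<in> I"
      using neutral_persp[OF I _ persp_sym[OF p1(2)]] pq(2) by (simp add: le_infI1)
    moreover have "q' \<in> I"
    proof -
      have "q' \<sqinter> f = \<beta>" using disjoint_mono[OF pq(3), of f q'] q' be by (simp add: inf_commute)
      moreover have "q' \<le> f \<squnion> e" using q'(1) pq(2) assms(4) by (metis order_trans sup_commute)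
      ultimately obtain s where s: "s \<le> e" "axis f q' s"
        using project be(1) by blast
      show ?thesis
      proof (rule central_modD[OF e s(1)])
        show "q' \<le> \<tau>" using q'(1) pq(2) by simp
        show "e \<sqinter> q' = \<beta>" using q'(3) by (simp add: inf_commute)
        show "persp s q'" using s(2) by (meson axis_persp persp_sym)
      qed
    qed
    ultimately show ?thesis using q'(4) neutral_join[OF I] by metis
  qed
  then show ?thesis using be by (auto simp: central_mod_def)
qed

lemma adjoin_disjoint:
  assumes I: "neutral_ideal I" and "e \<sqinter> f = \<beta>" and "r \<in> adjoin e I" and "r \<in> adjoin f I"
  shows "r \<in> I"
proof -
  obtain u v where u: "u \<in> I" "r \<le> e \<squnion> u" and v: "v \<in> I" "r \<le> f \<squnion> v"
    and r: "\<beta> \<le> r" "r \<le> \<tau>"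
    using assms(3,4) by (auto simp: adjoin_def)
  have be: "\<beta> \<le> e" "\<beta> \<le> f" using assms(2) by (metis inf_le1 inf_le2)+
  obtain r' where r': "r' \<le> r" "\<beta> \<le> r'" "r' \<sqinter> e = \<beta>" "(r \<sqinter> e) \<squnion> r' = r"
    using r(1) be(1) by (rule split_by)
  have "r' \<in> I"
    using r' u r by (intro neutral_remainder[OF I u(1), of r' e]) auto
  moreover have "r \<sqinter> e \<in> I"
  proof (rule neutral_remainder[OF I v(1)])
    show "r \<sqinter> e \<le> \<tau>" "r \<sqinter> e \<le> f \<squnion> v" using r v by (auto intro: le_infI1)
    show "(r \<sqinter> e) \<sqinter> f = \<beta>"
      using disjoint_mono[OF assms(2), of "r \<sqinter> e" f] r be by simp
  qed
  ultimately show ?thesis using r'(4) neutral_join[OF I] by metis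
qed

text \<open>
  Perspectivity of the images in the quotient by \<open>I\<close>, expressed by honestly perspective elements that
  exhaust \<open>a\<close> and \<open>c\<close> up to \<open>I\<close>. Since only two elements of \<open>I\<close> are involved, the property passes from
  the union of a chain of ideals to a member of the chain.
\<close>
definition persp_mod :: "'a set \<Rightarrow> 'a \<Rightarrow> 'a \<Rightarrow> bool" where
  "persp_mod I a c \<longleftrightarrow>
     (\<exists>p q. p \<le> a \<and> q \<le> c \<and> persp p q \<and> (\<exists>u\<in>I. a \<le> p \<squnion> u) \<and> (\<exists>v\<in>I. c \<le> q \<squnion> v))"

text \<open>
  Perspective \<open>p\<close> and \<open>q\<close> that match \<open>a\<close> and \<open>c\<close> up to \<open>f\<close> may be cut down to \<open>e\<close>. First \<open>p\<close> is replaced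
  by \<open>p \<sqinter> e\<close> and \<open>q\<close> by the image \<open>q1\<close>, then \<open>q1\<close> by \<open>q1 \<sqinter> e\<close> and \<open>p \<sqinter> e\<close> by its image. The first cut loses
  elements below \<open>f\<close> up to \<open>I\<close>; the second one loses only elements of \<open>I\<close> because \<open>e\<close> is central.
\<close>
lemma persp_mod_below_summand:
  assumes I: "neutral_ideal I" and e: "central_mod I e" and ef: "e \<sqinter> f = \<beta>" "e \<squnion> f = \<tau>"
    and "a \<le> \<tau>" and "c \<le> \<tau>" and "persp_mod (adjoin f I) a c"
  obtains p q u v where "p \<le> a" and "q \<le> c" and "p \<le> e" and "q \<le> e" and "persp p q"
    and "u \<in> adjoin f I" and "a \<le> p \<squnion> u" and "v \<in> adjoin f I" and "c \<le> q \<squnion> v"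
proof -
  let ?J = "adjoin f I"
  have be: "\<beta> \<le> e" "\<beta> \<le> f" "f \<le> \<tau>" using ef by (metis inf_le1 inf_le2 sup_ge2)+
  have J: "neutral_ideal ?J"
    by (rule neutral_ideal_adjoin[OF I central_mod_complement[OF I e ef]])
  have fJ: "f \<in> ?J" using I be(2,3) by (rule generator_in_adjoin)
  obtain p q u v where p: "p \<le> a" and q: "q \<le> c" and pq: "persp p q"
    and u: "u \<in> ?J" "a \<le> p \<squnion> u" and v: "v \<in> ?J" "c \<le> q \<squnion> v"
    using assms(7) unfolding persp_mod_def by blast
  obtain x where x: "axis x p q" using pq unfolding persp_def by blast
  have bp: "\<beta> \<le> p" using axis_lower[OF x] by simp
  then obtain p' where p': "p' \<le> p" "\<beta> \<le> p'" "p' \<sqinter> e = \<beta>" "(p \<sqinter> e) \<squnion> p' = p"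
    using be(1) by (rule split_by)
  have p'J: "p' \<in> ?J"
    using p' p assms(5) ef(2) by (intro neutral_remainder[OF J fJ, of p' e]) auto
  obtain q1 q' where q1: "axis x (p \<sqinter> e) q1" "axis x p' q'" "q = q1 \<squnion> q'"
    using transport_join[OF x p'(4)[symmetric]] bp be p'(2) by auto
  have q\<tau>: "q' \<le> \<tau>" "q1 \<le> \<tau>" using q1(3) q assms(6) by auto
  have q'J: "q' \<in> ?J"
    using neutral_persp[OF J p'J axis_persp[OF q1(2)]] q\<tau> by simp
  have "\<beta> \<le> q1" using axis_lower[OF q1(1)] by simp
  then obtain q3 where q3: "q3 \<le> q1" "\<beta> \<le> q3" "q3 \<sqinter> e = \<beta>" "(q1 \<sqinter> e) \<squnion> q3 = q1"
    using be(1) by (rule split_by)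
  obtain p2 p3 where p2: "axis x (q1 \<sqinter> e) p2" "axis x q3 p3" "p \<sqinter> e = p2 \<squnion> p3"
    using transport_join[OF axis_sym[OF q1(1)] q3(4)[symmetric]] \<open>\<beta> \<le> q1\<close> be q3(2) by auto
  have "q3 \<in> I"
  proof (rule central_modD[OF e])
    show "p3 \<le> e" using p2(3) by (metis inf_le2 le_supE)
    show "q3 \<le> \<tau>" using q3(1) q\<tau> by simp
    show "e \<sqinter> q3 = \<beta>" using q3(3) by (simp add: inf_commute)
    show "persp p3 q3" using p2(2) by (meson axis_persp persp_sym)
  qed
  moreover have p3p: "p3 \<le> p" using p2(3) by (metis inf_le1 le_supE)
  ultimately have "p3 \<in> I"
    using neutral_persp[OF I _ axis_persp[OF p2(2)]] p assms(5) by auto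
  with \<open>q3 \<in> I\<close> have J3: "q3 \<in> ?J" "p3 \<in> ?J" using adjoin_superset[OF I] by auto
  show ?thesis
  proof
    show "p2 \<le> a" using p2(3) p by (metis inf_le1 le_supE order_trans)
    show "q1 \<sqinter> e \<le> c" using q1(3) q by (metis inf_le1 le_supE order_trans)
    show "p2 \<le> e" using p2(3) by (metis inf_le2 le_supE)
    show "q1 \<sqinter> e \<le> e" by simp
    show "persp p2 (q1 \<sqinter> e)" using p2(1) by (meson axis_persp persp_sym)
    show "p3 \<squnion> p' \<squnion> u \<in> ?J" "q3 \<squnion> q' \<squnion> v \<in> ?J"
      using J3 p'J q'J u(1) v(1) by (simp_all add: neutral_join[OF J])
    have "p = p2 \<squnion> p3 \<squnion> p'" using p'(4) p2(3) by simp
    then show "a \<le> p2 \<squnion> (p3 \<squnion> p' \<squnion> u)" using u(2) by (simp add: sup_assoc)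
    have "q = (q1 \<sqinter> e) \<squnion> q3 \<squnion> q'" using q1(3) q3(4) by simp
    then show "c \<le> (q1 \<sqinter> e) \<squnion> (q3 \<squnion> q' \<squnion> v)" using v(2) by (simp add: sup_assoc)
  qed
qed

text \<open>
  The solution obtained after annihilating \<open>f\<close> is cut down to \<open>e\<close>, the other one to \<open>f\<close>; the disjoint
  pairs are joined. What is left over lies in both enlarged ideals, whose intersection is \<open>I\<close>.
\<close>
lemma persp_mod_glue:
  assumes I: "neutral_ideal I" and e: "central_mod I e" and ef: "e \<sqinter> f = \<beta>" "e \<squnion> f = \<tau>"
    and "a \<le> \<tau>" and "c \<le> \<tau>" and "persp_mod (adjoin e I) a c" and "persp_mod (adjoin f I) a c"
  shows "persp_mod I a c"
proof -
  have f: "central_mod I f" using I e ef by (rule central_mod_complement)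
  have fe: "f \<sqinter> e = \<beta>" "f \<squnion> e = \<tau>" using ef by (simp_all add: inf_commute sup_commute)
  have Je: "neutral_ideal (adjoin e I)" and Jf: "neutral_ideal (adjoin f I)"
    using neutral_ideal_adjoin[OF I e] neutral_ideal_adjoin[OF I f] .
  obtain p1 q1 u1 v1 where 1: "p1 \<le> a" "q1 \<le> c" "p1 \<le> e" "q1 \<le> e" "persp p1 q1"
    "u1 \<in> adjoin f I" "a \<le> p1 \<squnion> u1" "v1 \<in> adjoin f I" "c \<le> q1 \<squnion> v1"
    using persp_mod_below_summand[OF I e ef assms(5,6,8)] by blast
  obtain p2 q2 u2 v2 where 2: "p2 \<le> a" "q2 \<le> c" "p2 \<le> f" "q2 \<le> f" "persp p2 q2"
    "u2 \<in> adjoin e I" "a \<le> p2 \<squnion> u2" "v2 \<in> adjoin e I" "c \<le> q2 \<squnion> v2"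
    using persp_mod_below_summand[OF I f fe assms(5,6,7)] by blast
  have rest: "\<exists>r\<in>I. d \<le> r1 \<squnion> r2 \<squnion> r"
    if "d \<le> \<tau>" "r1 \<le> d" "r2 \<le> d" "\<beta> \<le> r1" "\<beta> \<le> r2"
      "w1 \<in> adjoin f I" "d \<le> r1 \<squnion> w1" "w2 \<in> adjoin e I" "d \<le> r2 \<squnion> w2" for d r1 r2 w1 w2
  proof -
    have "\<beta> \<le> d" "\<beta> \<le> r1 \<squnion> r2" using that by (auto intro: le_supI1)
    then obtain r where r: "r \<le> d" "\<beta> \<le> r" "r \<sqinter> (r1 \<squnion> r2) = \<beta>" "(d \<sqinter> (r1 \<squnion> r2)) \<squnion> r = d"
      by (rule split_by)
    have "r \<sqinter> r1 = \<beta>" "r \<sqinter> r2 = \<beta>" using disjoint_mono[OF r(3)] r(2) that(4,5) by auto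
    then have "r \<in> adjoin f I" "r \<in> adjoin e I"
      using order_trans[OF r(1) that(1)] order_trans[OF r(1) that(7)] order_trans[OF r(1) that(9)]
        neutral_remainder[OF Jf that(6), of r r1] neutral_remainder[OF Je that(8), of r r2] by simp_all
    then have "r \<in> I" using adjoin_disjoint[OF I ef(1)] by simp
    moreover have "d \<le> r1 \<squnion> r2 \<squnion> r" using r(4) by (metis inf_le2 sup_mono order_refl)
    ultimately show ?thesis by blast
  qed
  have "\<exists>r\<in>I. a \<le> p1 \<squnion> p2 \<squnion> r" "\<exists>r\<in>I. c \<le> q1 \<squnion> q2 \<squnion> r"
    using persp_lower[OF 1(5)] persp_lower[OF 2(5)]
      rest[OF assms(5) 1(1) 2(1) _ _ 1(6,7) 2(6,7)] rest[OF assms(6) 1(2) 2(2) _ _ 1(8,9) 2(8,9)] by simp_all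
  moreover have "persp (p1 \<squnion> p2) (q1 \<squnion> q2)"
    using ef(1) 1(5,3,4) 2(5,3,4) by (rule persp_join)
  ultimately show ?thesis
    using 1(1,2) 2(1,2) unfolding persp_mod_def by (meson le_supI)
qed


section \<open>Homogeneous sequences\<close>

primrec join_upto :: "(nat \<Rightarrow> 'a) \<Rightarrow> nat \<Rightarrow> 'a" where
  "join_upto t 0 = \<beta>"
| "join_upto t (Suc m) = join_upto t m \<squnion> t m"

lemma join_upto_lower: "\<beta> \<le> join_upto t m"
  by (induction m) (auto intro: le_supI1)

lemma join_upto_upper: "j < m \<Longrightarrow> t j \<le> join_upto t m"
  by (induction m) (auto simp: less_Suc_eq intro: le_supI1)

lemma join_upto_least: "\<beta> \<le> y \<Longrightarrow> (\<And>j. j < m \<Longrightarrow> t j \<le> y) \<Longrightarrow> join_upto t m \<le> y"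
  by (induction m) auto

lemma join_upto_cong: "(\<And>j. j < m \<Longrightarrow> s j = t j) \<Longrightarrow> join_upto s m = join_upto t m"
  by (induction m) auto

lemma join_upto_mono: "(\<And>j. j < m \<Longrightarrow> s j \<le> t j) \<Longrightarrow> join_upto s m \<le> join_upto t m"
  by (rule join_upto_least[OF join_upto_lower]) (meson join_upto_upper order_trans)

definition independent :: "(nat \<Rightarrow> 'a) \<Rightarrow> nat \<Rightarrow> bool" where
  "independent t m \<longleftrightarrow> (\<forall>j<m. t j \<sqinter> join_upto t j = \<beta>)"

lemma independentD: "independent t m \<Longrightarrow> j < m \<Longrightarrow> t j \<sqinter> join_upto t j = \<beta>"
  by (simp add: independent_def)

lemma independent_lower: "independent t m \<Longrightarrow> j < m \<Longrightarrow> \<beta> \<le> t j"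
  unfolding independent_def by (metis inf_le1)

lemma independent_mono:
  assumes "independent t m" and "\<And>j. j < m \<Longrightarrow> s j \<le> t j" and "\<And>j. j < m \<Longrightarrow> \<beta> \<le> s j"
  shows "independent s m"
  unfolding independent_def
proof (intro allI impI)
  fix j assume j: "j < m"
  have "join_upto s j \<le> join_upto t j" using assms(2) j by (intro join_upto_mono) auto
  then show "s j \<sqinter> join_upto s j = \<beta>"
    using disjoint_mono[OF independentD[OF assms(1) j]] assms(2,3) j join_upto_lower by simp
qed

lemma independent_snoc:
  assumes "independent t m" and "q \<sqinter> join_upto t m = \<beta>"
  shows "independent (t(m := q)) (Suc m)"
  unfolding independent_def
proof (intro allI impI)
  fix j assume "j < Suc m"
  moreover have "join_upto (t(m := q)) j = join_upto t j" if "j \<le> m"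
    using that by (intro join_upto_cong) auto
  ultimately show "(t(m := q)) j \<sqinter> join_upto (t(m := q)) j = \<beta>"
    using assms independentD[OF assms(1)] by (auto simp: less_Suc_eq)
qed

text \<open>
  Perspectivity is demanded with the first member only: independence makes the members pairwise
  perspective by \<open>persp_trans_disjoint\<close>, and the star shape survives shrinking and extension at no
  cost. That the first member is outside \<open>I\<close> forces the others to be outside as well.
\<close>
definition homogeneous :: "'a set \<Rightarrow> nat \<Rightarrow> (nat \<Rightarrow> 'a) \<Rightarrow> bool" where
  "homogeneous I k e \<longleftrightarrow> e 0 \<notin> I \<and> independent e k \<and> (\<forall>j<k. e j \<le> \<tau> \<and> persp (e 0) (e j))"

lemma homogeneousD:
  assumes "homogeneous I k e"
  shows "e 0 \<notin> I" and "independent e k" and "\<And>j. j < k \<Longrightarrow> e j \<le> \<tau>" and "\<And>j. j < k \<Longrightarrow> persp (e 0) (e j)"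
  using assms unfolding homogeneous_def by blast+

lemma homogeneous_restrict:
  assumes e: "homogeneous I k e" and "\<beta> \<le> f" and "f \<le> e 0" and "f \<notin> I"
  obtains f' where "homogeneous I k f'" and "f' 0 = f" and "\<And>j. j < k \<Longrightarrow> f' j \<le> e j"
proof -
  have "\<exists>g. (j < k \<longrightarrow> g \<le> e j \<and> persp f g) \<and> (j = 0 \<longrightarrow> g = f)" for j
  proof (cases "j = 0")
    case True
    then show ?thesis using assms(2,3) persp_refl by auto
  next
    case False
    then show ?thesis
      using transport_persp[OF homogeneousD(4)[OF e] assms(2,3)] by metis
  qed
  then obtain f' where f': "\<And>j. j < k \<Longrightarrow> f' j \<le> e j" "\<And>j. j < k \<Longrightarrow> persp f (f' j)" "f' 0 = f"
    by metis
  have "independent f' k"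
  proof (rule independent_mono)
    show "independent e k" using e by (rule homogeneousD)
    show "f' j \<le> e j" "\<beta> \<le> f' j" if "j < k" for j
      using f'(1)[OF that] persp_lower[OF f'(2)[OF that]] by simp_all
  qed
  moreover have "f' j \<le> \<tau>" if "j < k" for j
    using f'(1)[OF that] homogeneousD(3)[OF e that] by (rule order_trans)
  ultimately have "homogeneous I k f'"
    unfolding homogeneous_def f'(3) using f'(2) assms(4) by blast
  then show ?thesis using f'(3,1) by (rule that)
qed

lemma homogeneous_snoc:
  assumes e: "homogeneous I k e" and "0 < k" and "q \<le> \<tau>" and "q \<sqinter> join_upto e k = \<beta>"
    and "persp (e 0) q"
  shows "homogeneous I (Suc k) (e(k := q))"
proof -
  have "independent (e(k := q)) (Suc k)"
    using homogeneousD(2)[OF e] assms(4) by (rule independent_snoc)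
  moreover have "(e(k := q)) j \<le> \<tau> \<and> persp (e 0) ((e(k := q)) j)" if "j < Suc k" for j
    using that homogeneousD(3,4)[OF e, of j] assms(3,5) by (cases "j = k") simp_all
  ultimately show ?thesis
    using assms(2) homogeneousD(1)[OF e] unfolding homogeneous_def by simp
qed

text \<open>
  Peeling off the last summand, \<open>p\<close> splits into its meet with the join of the earlier ones and a part
  that projects into the last one.
\<close>
lemma piece_in_summand:
  assumes I: "neutral_ideal I" and "independent e k" and "\<beta> \<le> p" and "p \<le> join_upto e k" and "p \<notin> I"
  shows "\<exists>j<k. \<exists>p' r. p' \<le> p \<and> p' \<notin> I \<and> r \<le> e j \<and> persp p' r"
  using assms(2-)
proof (induction k arbitrary: p)
  case 0
  then have "p = \<beta>" by simp
  then show ?case using 0 neutral_bot[OF I] by simp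
next
  case (Suc k)
  have ek: "\<beta> \<le> e k" using Suc.prems(1) independent_lower by blast
  obtain p' where p': "p' \<le> p" "\<beta> \<le> p'" "p' \<sqinter> join_upto e k = \<beta>" "(p \<sqinter> join_upto e k) \<squnion> p' = p"
    using Suc.prems(2) join_upto_lower by (rule split_by)
  show ?case
  proof (cases "p \<sqinter> join_upto e k \<in> I")
    case False
    have "independent e k" using Suc.prems(1) by (simp add: independent_def)
    then obtain j p'' r where "j < k" "p'' \<le> p \<sqinter> join_upto e k" "p'' \<notin> I" "r \<le> e j" "persp p'' r"
      using Suc.IH[of "p \<sqinter> join_upto e k"] False Suc.prems(2) join_upto_lower by auto
    then show ?thesis using less_SucI by (metis le_infE)
  next
    case True
    then have "p' \<notin> I" using neutral_join[OF I True] p'(4) Suc.prems(4) by metis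
    moreover have "p' \<le> join_upto e k \<squnion> e k" using p'(1) Suc.prems(3) by simp
    then obtain s where "s \<le> e k" "axis (join_upto e k) p' s"
      using p'(3) ek by (rule project)
    ultimately show ?thesis using p'(1) axis_persp by blast
  qed
qed

lemma piece_in_homogeneous:
  assumes I: "neutral_ideal I" and e: "homogeneous I k e" and "\<beta> \<le> p" and "p \<le> join_upto e k" and "p \<notin> I"
  obtains p' r r0 where "p' \<le> p" and "p' \<notin> I" and "r \<le> join_upto e k" and "r0 \<le> e 0"
    and "persp p' r" and "persp r r0"
proof -
  obtain j p' r where j: "j < k" "p' \<le> p" "p' \<notin> I" "r \<le> e j" "persp p' r"
    using piece_in_summand[OF I homogeneousD(2)[OF e] assms(3-)] by blast
  obtain r0 where "r0 \<le> e 0" "persp r r0"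
    using transport_persp[OF persp_sym[OF homogeneousD(4)[OF e j(1)]] _ j(4)] persp_lower[OF j(5)] by blast
  moreover have "r \<le> join_upto e k" using j(4) join_upto_upper[OF j(1)] by (rule order_trans)
  ultimately show ?thesis using that j by blast
qed

lemma persp_not_in:
  assumes "neutral_ideal I" and "persp x y" and "x \<notin> I" and "x \<le> \<tau>"
  shows "y \<notin> I"
  using neutral_persp[OF assms(1) _ persp_sym[OF assms(2)]] assms(3,4) by blast

lemma homogeneous_join_le: "homogeneous I k e \<Longrightarrow> join_upto e k \<le> \<tau>"
  using bounds homogeneousD(3) by (intro join_upto_least) auto

text \<open>
  Suppose that \<open>q\<close> is disjoint from the join, is perspective to something below it, and is not in \<open>I\<close>. Some
  part \<open>q'\<close> outside \<open>I\<close> is then perspective to a part of a member, and through it to a part \<open>r0\<close> of the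
  first member; the chain can be shortened because \<open>q'\<close> is disjoint from everything else in it.
  Restricting the sequence to \<open>r0\<close> and appending \<open>q'\<close> contradicts maximality.
\<close>
lemma maximal_homogeneous_central:
  assumes I: "neutral_ideal I" and e: "homogeneous I k e" and "0 < k"
    and max: "\<And>e. \<not> homogeneous I (Suc k) e"
  shows "central_mod I (join_upto e k)"
proof -
  let ?E = "join_upto e k"
  have "q \<in> I" if p: "p \<le> ?E" and q: "q \<le> \<tau>" and Eq: "?E \<sqinter> q = \<beta>" and pq: "persp p q" for p q
  proof (rule ccontr)
    assume "q \<notin> I"
    then have "p \<notin> I" by (rule persp_not_in[OF I persp_sym[OF pq] _ q])
    then obtain p' r r0 where r: "p' \<le> p" "p' \<notin> I" "r \<le> ?E" "r0 \<le> e 0" "persp p' r" "persp r r0"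
      using piece_in_homogeneous[OF I e _ p] persp_lower[OF pq] by blast
    have low: "\<beta> \<le> p'" "\<beta> \<le> r" "\<beta> \<le> r0" using persp_lower[OF r(5)] persp_lower[OF r(6)] by auto
    obtain q' where q': "q' \<le> q" "persp p' q'"
      using transport_persp[OF pq low(1) r(1)] by blast
    have bq': "\<beta> \<le> q'" using persp_lower[OF q'(2)] by simp
    have disj: "q' \<sqinter> z = \<beta>" if "z \<le> ?E" "\<beta> \<le> z" for z
      using disjoint_mono[OF Eq that(1) q'(1) that(2) bq'] by (simp add: inf_commute)
    have r0E: "r0 \<le> ?E" using r(4) join_upto_upper[OF assms(3)] by (rule order_trans)
    have "persp r q'"
    proof (rule persp_trans_disjoint[OF persp_sym[OF r(5)] q'(2)])
      show "q' \<sqinter> (r \<squnion> p') = \<beta>"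
        using r(1,3) p low by (intro disj) (auto intro: le_supI1)
    qed
    then have "persp r0 q'"
    proof (rule persp_trans_disjoint[OF persp_sym[OF r(6)]])
      show "q' \<sqinter> (r0 \<squnion> r) = \<beta>"
        using r(3) r0E low by (intro disj) (auto intro: le_supI1)
    qed
    have E\<tau>: "?E \<le> \<tau>" using e by (rule homogeneous_join_le)
    have "r \<notin> I" by (rule persp_not_in[OF I r(5,2)]) (meson E\<tau> p r(1) order_trans)
    then have "r0 \<notin> I" by (rule persp_not_in[OF I r(6)]) (meson E\<tau> r(3) order_trans)
    then obtain f where f: "homogeneous I k f" "f 0 = r0" "\<And>j. j < k \<Longrightarrow> f j \<le> e j"
      using homogeneous_restrict[OF e low(3) r(4)] by blast
    have "join_upto f k \<le> ?E" using f(3) by (rule join_upto_mono)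
    then have "q' \<sqinter> join_upto f k = \<beta>" using join_upto_lower by (rule disj)
    then have "homogeneous I (Suc k) (f(k := q'))"
      using f(1,2) \<open>persp r0 q'\<close> assms(3) q q'(1) by (intro homogeneous_snoc) auto
    then show False using max by blast
  qed
  then show ?thesis
    using join_upto_lower homogeneous_join_le[OF e] by (auto simp: central_mod_def)
qed

text \<open>
  In the quotient by \<open>I\<close>: some nonzero part of \<open>x\<close> is perspective to a part of \<open>y\<close>.
\<close>
definition linked :: "'a set \<Rightarrow> 'a \<Rightarrow> 'a \<Rightarrow> bool" where
  "linked I x y \<longleftrightarrow> (\<exists>x' y'. x' \<le> x \<and> y' \<le> y \<and> x' \<notin> I \<and> persp x' y')"

lemma linkedI: "persp x' y' \<Longrightarrow> x' \<notin> I \<Longrightarrow> x' \<le> x \<Longrightarrow> y' \<le> y \<Longrightarrow> linked I x y"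
  unfolding linked_def by blast

lemma linked_mono: "linked I x y \<Longrightarrow> x \<le> x' \<Longrightarrow> y \<le> y' \<Longrightarrow> linked I x' y'"
  unfolding linked_def by (meson order_trans)

text \<open>
  Two elements perspective to a third one need not be perspective, but they have perspective parts.
  A common part of \<open>u\<close> and \<open>w\<close> outside \<open>I\<close> is perspective to itself. Otherwise \<open>u\<close> and \<open>w\<close> may be taken
  disjoint, and some part of \<open>h\<close> outside \<open>I\<close> is either independent of them, or below one of them, or below
  \<open>u \<squnion> w\<close> and disjoint from each. In the last situation \<open>h\<close> is an axis, like the third point on a line.
\<close>
lemma linked_trans_via:
  assumes I: "neutral_ideal I" and uh: "persp u h" and hw: "persp h w"
    and "u \<notin> I" and "u \<le> \<tau>" and "h \<le> \<tau>"
  shows "linked I u w"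
proof (cases "u \<sqinter> w \<in> I")
  case False
  have "\<beta> \<le> u \<sqinter> w" using persp_lower[OF uh] persp_lower[OF hw] by simp
  then have "persp (u \<sqinter> w) (u \<sqinter> w)" by (rule persp_refl)
  moreover have "u \<sqinter> w \<le> u" "u \<sqinter> w \<le> w" by simp_all
  ultimately show ?thesis using False unfolding linked_def by blast
next
  case True
  have low: "\<beta> \<le> u" "\<beta> \<le> w" using persp_lower[OF uh] persp_lower[OF hw] by auto
  obtain u1 where u1: "u1 \<le> u" "\<beta> \<le> u1" "u1 \<sqinter> w = \<beta>" "(u \<sqinter> w) \<squnion> u1 = u"
    using low by (rule split_by)
  have u1I: "u1 \<notin> I" using neutral_join[OF I True] u1(4) assms(4) by metis
  obtain h1 where h1: "h1 \<le> h" "persp u1 h1"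
    using transport_persp[OF uh u1(2,1)] by blast
  have bh1: "\<beta> \<le> h1" using persp_lower[OF h1(2)] by simp
  obtain w1 where w1: "w1 \<le> w" "persp h1 w1"
    using transport_persp[OF hw bh1 h1(1)] by blast
  have bw1: "\<beta> \<le> w1" using persp_lower[OF w1(2)] by simp
  have u1w1: "u1 \<sqinter> w1 = \<beta>" using disjoint_mono[OF u1(3) order_refl w1(1) u1(2) bw1] .
  have h1I: "h1 \<notin> I" using persp_not_in[OF I h1(2) u1I] u1(1) assms(5) by simp
  have h1\<tau>: "h1 \<le> \<tau>" using h1(1) assms(6) by simp
  \<comment> \<open>\<open>h2\<close> is the part of \<open>h1\<close> that is independent of \<open>u1\<close> and \<open>w1\<close>. Since
    \<open>h1\<close> is outside \<open>I\<close>, so is \<open>h2\<close> or the part of \<open>h1\<close> below \<open>u1 \<squnion> w1\<close>.\<close>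
  have "\<beta> \<le> u1 \<squnion> w1" using u1(2) by (rule le_supI1)
  with bh1 obtain h2 where h2: "h2 \<le> h1" "\<beta> \<le> h2" "h2 \<sqinter> (u1 \<squnion> w1) = \<beta>" "(h1 \<sqinter> (u1 \<squnion> w1)) \<squnion> h2 = h1"
    by (rule split_by)
  show ?thesis
  proof (cases "h1 \<sqinter> (u1 \<squnion> w1) \<in> I")
    case True
    then have h2I: "h2 \<notin> I" using neutral_join[OF I True] h2(4) h1I by metis
    obtain u2 where u2: "u2 \<le> u1" "persp h2 u2"
      using transport_persp[OF persp_sym[OF h1(2)] h2(2,1)] by blast
    obtain w2 where w2: "w2 \<le> w1" "persp h2 w2"
      using transport_persp[OF w1(2) h2(2,1)] by blast
    have b2: "\<beta> \<le> u2" "\<beta> \<le> w2" using persp_lower[OF u2(2)] persp_lower[OF w2(2)] by auto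
    have "w2 \<sqinter> (u2 \<squnion> h2) = \<beta>"
    proof (rule disjoint_rotate)
      show "w2 \<sqinter> u2 = \<beta>"
        using disjoint_mono[OF u1w1 u2(1) w2(1) b2] by (simp add: inf_commute)
      have "w2 \<squnion> u2 \<le> u1 \<squnion> w1" using u2(1) w2(1) by (simp add: le_supI1 le_supI2)
      then show "h2 \<sqinter> (w2 \<squnion> u2) = \<beta>"
        using disjoint_mono[OF h2(3) order_refl _ h2(2)] b2 by (simp add: le_supI1)
    qed
    then have "persp u2 w2"
      by (rule persp_trans_disjoint[OF persp_sym[OF u2(2)] w2(2)])
    moreover have "u2 \<notin> I" using persp_not_in[OF I u2(2) h2I] h2(1) h1\<tau> by simp
    ultimately show ?thesis
      using order_trans[OF u2(1) u1(1)] order_trans[OF w2(1) w1(1)] by (rule linkedI)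
  next
    case False
    define h3 where "h3 = h1 \<sqinter> (u1 \<squnion> w1)"
    have h3: "h3 \<notin> I" "h3 \<le> h1" "h3 \<le> u1 \<squnion> w1" "\<beta> \<le> h3"
      using False bh1 u1(2) by (auto simp: h3_def intro: le_supI1)
    have h3\<tau>: "h3 \<le> \<tau>" using h3(2) h1\<tau> by simp
    show ?thesis
    proof (cases "h3 \<sqinter> w1 \<in> I")
      case False
      have "\<beta> \<le> h3 \<sqinter> w1" using h3(4) bw1 by simp
      moreover have "h3 \<sqinter> w1 \<le> h1" using h3(2) by (simp add: le_infI1)
      ultimately obtain u2 where u2: "u2 \<le> u1" "persp (h3 \<sqinter> w1) u2"
        by (rule transport_persp[OF persp_sym[OF h1(2)]])
      have "u2 \<notin> I" using persp_not_in[OF I u2(2) False] h3\<tau> by (simp add: le_infI1)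
      moreover have "h3 \<sqinter> w1 \<le> w" using w1(1) by (simp add: le_infI2)
      ultimately show ?thesis
        using linkedI[OF persp_sym[OF u2(2)] _ order_trans[OF u2(1) u1(1)]] by blast
    next
      case True
      obtain h4 where h4: "h4 \<le> h3" "\<beta> \<le> h4" "h4 \<sqinter> w1 = \<beta>" "(h3 \<sqinter> w1) \<squnion> h4 = h3"
        using h3(4) bw1 by (rule split_by)
      have h4I: "h4 \<notin> I" using neutral_join[OF I True] h4(4) h3(1) by metis
      show ?thesis
      proof (cases "h4 \<sqinter> u1 \<in> I")
        case False
        have "\<beta> \<le> h4 \<sqinter> u1" using h4(2) u1(2) by simp
        moreover have "h4 \<sqinter> u1 \<le> h1" using h4(1) h3(2) by (simp add: le_infI1)
        ultimately obtain w2 where w2: "w2 \<le> w1" "persp (h4 \<sqinter> u1) w2"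
          by (rule transport_persp[OF w1(2)])
        have "h4 \<sqinter> u1 \<le> u" using u1(1) by (simp add: le_infI2)
        then show ?thesis
          using linkedI[OF w2(2) False _ order_trans[OF w2(1) w1(1)]] by blast
      next
        case True
        obtain h5 where h5: "h5 \<le> h4" "\<beta> \<le> h5" "h5 \<sqinter> u1 = \<beta>" "(h4 \<sqinter> u1) \<squnion> h5 = h4"
          using h4(2) u1(2) by (rule split_by)
        have h5I: "h5 \<notin> I" using neutral_join[OF I True] h5(4) h4I by metis
        have h5w: "h5 \<sqinter> w1 = \<beta>" using disjoint_mono[OF h4(3) h5(1) order_refl h5(2) bw1] .
        have h5le: "h5 \<le> u1 \<squnion> w1" "h5 \<le> \<tau>"
          using h5(1) h4(1) h3(3) h3\<tau> by (meson order_trans)+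
        \<comment> \<open>The projections of \<open>h5\<close> into \<open>u1\<close> along \<open>w1\<close> and into \<open>w1\<close> along \<open>u1\<close>; \<open>h5\<close> itself is
          an axis for them.\<close>
        define u2 where "u2 = u1 \<sqinter> (h5 \<squnion> w1)"
        define w2 where "w2 = w1 \<sqinter> (h5 \<squnion> u1)"
        have "u2 \<squnion> w1 = h5 \<squnion> w1"
          using modular[of w1 "h5 \<squnion> w1" u1] h5le(1)
          by (simp add: u2_def sup_commute inf_absorb2)
        moreover have "w2 \<squnion> u1 = h5 \<squnion> u1"
          using modular[of u1 "h5 \<squnion> u1" w1] h5le(1)
          by (simp add: w2_def sup_commute inf_absorb2)
        moreover have b2: "\<beta> \<le> u2" "\<beta> \<le> w2"
          using u1(2) bw1 by (simp_all add: u2_def w2_def le_supI2)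
        moreover have "u2 \<sqinter> w1 = \<beta>"
          by (rule disjoint_mono[OF u1w1 _ order_refl b2(1) bw1]) (simp add: u2_def)
        moreover have "u2 \<sqinter> h5 = \<beta>"
          using disjoint_mono[OF h5(3) order_refl _ h5(2) b2(1)] by (simp add: u2_def inf_commute)
        moreover have "w2 \<sqinter> h5 = \<beta>"
          using disjoint_mono[OF h5w order_refl _ h5(2) b2(2)] by (simp add: w2_def inf_commute)
        moreover have "u2 \<squnion> h5 = w2 \<squnion> h5"
        proof -
          have "h5 \<squnion> (u1 \<sqinter> (h5 \<squnion> w1)) = (h5 \<squnion> u1) \<sqinter> (h5 \<squnion> w1)"
            "h5 \<squnion> (w1 \<sqinter> (h5 \<squnion> u1)) = (h5 \<squnion> w1) \<sqinter> (h5 \<squnion> u1)"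
            by (simp_all add: modular)
          then show ?thesis by (simp add: u2_def w2_def sup_commute inf_commute)
        qed
        ultimately have "axis h5 u2 w2" "axis w1 h5 u2"
          using h5w by (simp_all add: axis_def)
        then have "persp u2 w2" "u2 \<notin> I"
          using axis_persp persp_not_in[OF I axis_persp h5I h5le(2)] by simp_all
        moreover have "u2 \<le> u" "w2 \<le> w"
          using u1(1) w1(1) by (simp_all add: u2_def w2_def le_infI1)
        ultimately show ?thesis by (rule linkedI)
      qed
    qed
  qed
qed

section \<open>Atoms modulo an ideal\<close>

definition indecomposable_mod :: "'a set \<Rightarrow> bool" where
  "indecomposable_mod I \<longleftrightarrow>
     (\<forall>e f. central_mod I e \<longrightarrow> e \<sqinter> f = \<beta> \<longrightarrow> e \<squnion> f = \<tau> \<longrightarrow> e \<in> I \<or> f \<in> I)"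

lemma maximal_homogeneous_full:
  assumes I: "neutral_ideal I" "indecomposable_mod I" and e: "homogeneous I k e" "0 < k"
    and max: "\<And>e. \<not> homogeneous I (Suc k) e"
    and "z \<le> \<tau>" and "z \<sqinter> join_upto e k = \<beta>"
  shows "z \<in> I"
proof -
  let ?E = "join_upto e k"
  have E: "central_mod I ?E" using I(1) e max by (rule maximal_homogeneous_central)
  have bE: "\<beta> \<le> ?E" "?E \<le> \<tau>" using E by (auto simp: central_mod_def)
  then obtain f where f: "?E \<sqinter> f = \<beta>" "?E \<squnion> f = \<tau>" using complement[of \<beta> ?E \<tau>] by blast
  have "e 0 \<le> ?E" using e(2) by (rule join_upto_upper)
  moreover have "\<beta> \<le> e 0" using homogeneousD(2)[OF e(1)] e(2) by (rule independent_lower)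
  ultimately have "?E \<notin> I" using homogeneousD(1)[OF e(1)] neutral_down[OF I(1)] by blast
  then have "f \<in> I" using I(2) E f unfolding indecomposable_mod_def by blast
  then show ?thesis using assms(6,7) f(2) by (intro neutral_remainder[OF I(1), of f z ?E]) auto
qed

text \<open>
  If \<open>f \<sqinter> g\<close> were in \<open>I\<close>, then the part \<open>g'\<close> of \<open>g\<close> outside \<open>f\<close> would not be. But \<open>f\<close> starts a homogeneous
  sequence of the same length below \<open>e\<close>, whose join is disjoint from \<open>g'\<close> by independence of the
  \<open>e j\<close>, although that join is also everything modulo \<open>I\<close>.
\<close>
lemma maximal_homogeneous_atom:
  assumes I: "neutral_ideal I" "indecomposable_mod I" and e: "homogeneous I k e" "0 < k"
    and max: "\<And>e. \<not> homogeneous I (Suc k) e"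
    and f: "\<beta> \<le> f" "f \<le> e 0" "f \<notin> I" and g: "\<beta> \<le> g" "g \<le> e 0" "g \<notin> I"
  shows "f \<sqinter> g \<notin> I"
proof
  assume "f \<sqinter> g \<in> I"
  then have fg: "g \<sqinter> f \<in> I" by (simp add: inf_commute)
  obtain g' where g': "g' \<le> g" "\<beta> \<le> g'" "g' \<sqinter> f = \<beta>" "(g \<sqinter> f) \<squnion> g' = g"
    using g(1) f(1) by (rule split_by)
  obtain F where F: "homogeneous I k F" "F 0 = f" "\<And>j. j < k \<Longrightarrow> F j \<le> e j"
    using homogeneous_restrict[OF e(1) f] by blast
  have "g' \<sqinter> join_upto F m = \<beta>" if "m \<le> k" for m
    using that
  proof (induction m)
    case 0
    then show ?case using g'(2) by (simp add: inf_absorb2)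
  next
    case (Suc m)
    then have IH: "g' \<sqinter> join_upto F m = \<beta>" and m: "m < k" by auto
    show ?case
    proof (cases "m = 0")
      case True
      then show ?thesis using g'(3) F(2) f(1) by (simp add: sup_absorb2)
    next
      case False
      have "join_upto F m \<le> join_upto e m" using F(3) m by (intro join_upto_mono) auto
      moreover have "F m \<sqinter> join_upto e m = \<beta>"
        using disjoint_mono[OF independentD[OF homogeneousD(2)[OF e(1)] m] F(3)[OF m] order_refl]
          independent_lower[OF homogeneousD(2)[OF F(1)] m] join_upto_lower by blast
      ultimately have "join_upto e m \<sqinter> (join_upto F m \<squnion> F m) = join_upto F m"
        using join_upto_lower by (intro meet_join_absorb) auto
      moreover have "g' \<le> join_upto e m"
        using g'(1) g(2) False join_upto_upper[of 0 m e] by (meson order_trans gr0I)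
      ultimately have "g' \<sqinter> (join_upto F m \<squnion> F m) = g' \<sqinter> join_upto F m"
        by (metis inf_absorb1 inf_assoc)
      then show ?thesis using IH by simp
    qed
  qed
  moreover have "g' \<le> \<tau>" using g'(1) g(2) homogeneousD(3)[OF e] by (meson order_trans)
  ultimately have "g' \<in> I"
    using maximal_homogeneous_full[OF I F(1) e(2) max] by blast
  then show False using g'(4) g(3) neutral_join[OF I(1) fg] by metis
qed

text \<open>
  Both elements have parts perspective to parts \<open>f\<close>, \<open>g\<close> of the first member of a maximal sequence, and
  \<open>f \<sqinter> g\<close>, which is outside \<open>I\<close>, mediates between them.
\<close>
lemma all_linked:
  assumes I: "neutral_ideal I" "indecomposable_mod I" and e: "homogeneous I k e" "0 < k"
    and max: "\<And>e. \<not> homogeneous I (Suc k) e"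
    and x: "\<beta> \<le> x" "x \<le> \<tau>" "x \<notin> I" and y: "\<beta> \<le> y" "y \<le> \<tau>" "y \<notin> I"
  shows "linked I x y"
proof -
  let ?E = "join_upto e k"
  have E\<tau>: "?E \<le> \<tau>" using e(1) by (rule homogeneous_join_le)
  have to_e0: "linked I z (e 0)" if z: "\<beta> \<le> z" "z \<le> \<tau>" "z \<notin> I" for z
  proof -
    obtain z' where z': "z' \<le> z" "\<beta> \<le> z'" "z' \<sqinter> ?E = \<beta>" "(z \<sqinter> ?E) \<squnion> z' = z"
      using z(1) join_upto_lower by (rule split_by)
    have "z' \<in> I" using maximal_homogeneous_full[OF I e max _ z'(3)] z'(1) z(2) by simp
    then have "z \<sqinter> ?E \<notin> I" using neutral_join[OF I(1)] z'(4) z(3) by metis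
    then obtain p r r0 where p: "p \<le> z \<sqinter> ?E" "p \<notin> I" "r \<le> ?E" "r0 \<le> e 0" "persp p r" "persp r r0"
      using piece_in_homogeneous[OF I(1) e(1), of "z \<sqinter> ?E"] z(1) join_upto_lower by auto
    have "linked I p r0"
    proof (rule linked_trans_via[OF I(1) p(5,6,2)])
      show "p \<le> \<tau>" using p(1) z(2) by (meson le_infE order_trans)
      show "r \<le> \<tau>" using p(3) E\<tau> by (rule order_trans)
    qed
    moreover have "p \<le> z" using p(1) by simp
    ultimately show ?thesis using p(4) by (rule linked_mono)
  qed
  obtain x' f where f: "x' \<le> x" "f \<le> e 0" "x' \<notin> I" "persp x' f"
    using to_e0[OF x] unfolding linked_def by blast
  obtain y' g where g: "y' \<le> y" "g \<le> e 0" "y' \<notin> I" "persp y' g"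
    using to_e0[OF y] unfolding linked_def by blast
  have low: "\<beta> \<le> f" "\<beta> \<le> g" using persp_lower[OF f(4)] persp_lower[OF g(4)] by simp_all
  have fI: "f \<notin> I" using persp_not_in[OF I(1) f(4,3)] f(1) x(2) by simp
  have gI: "g \<notin> I" using persp_not_in[OF I(1) g(4,3)] g(1) y(2) by simp
  have h: "f \<sqinter> g \<notin> I" "\<beta> \<le> f \<sqinter> g"
    using maximal_homogeneous_atom[OF I e max low(1) f(2) fI low(2) g(2) gI] low by auto
  have h\<tau>: "f \<sqinter> g \<le> \<tau>" using order_trans[OF f(2) homogeneousD(3)[OF e]] by (rule le_infI1)
  obtain x'' where x'': "x'' \<le> x'" "persp (f \<sqinter> g) x''"
    using transport_persp[OF persp_sym[OF f(4)] h(2)] by auto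
  obtain y'' where y'': "y'' \<le> y'" "persp (f \<sqinter> g) y''"
    using transport_persp[OF persp_sym[OF g(4)] h(2)] by auto
  have "x'' \<notin> I" using persp_not_in[OF I(1) x''(2) h(1) h\<tau>] .
  moreover have "x'' \<le> \<tau>" using x''(1) f(1) x(2) by simp
  ultimately have "linked I x'' y''"
    using linked_trans_via[OF I(1) persp_sym[OF x''(2)] y''(2) _ _ h\<tau>] by blast
  then show ?thesis
    using order_trans[OF x''(1) f(1)] order_trans[OF y''(1) g(1)] by (rule linked_mono)
qed


section \<open>Rank modulo an ideal\<close>

text \<open>
  Each new \<open>t\<close> is linked to the first member of the sequence built so far; the whole sequence is restricted
  to the linked part before the new member is appended. This bounds the length of independent
  sequences by that of homogeneous ones.
\<close>
lemma homogeneous_from_independent: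
  assumes I: "neutral_ideal I"
    and linked: "\<And>x y. \<beta> \<le> x \<Longrightarrow> x \<le> \<tau> \<Longrightarrow> x \<notin> I \<Longrightarrow> \<beta> \<le> y \<Longrightarrow> y \<le> \<tau> \<Longrightarrow> y \<notin> I \<Longrightarrow> linked I x y"
    and t: "independent t (Suc m)" "\<And>j. j \<le> m \<Longrightarrow> t j \<notin> I" "\<And>j. j \<le> m \<Longrightarrow> t j \<le> \<tau>"
  shows "\<exists>r. homogeneous I (Suc m) r \<and> (\<forall>j\<le>m. r j \<le> t j)"
  using t
proof (induction m)
  case 0
  have "\<beta> \<le> t 0" using 0(1) by (rule independent_lower) simp
  then have "homogeneous I (Suc 0) t"
    using 0 persp_refl by (simp add: homogeneous_def)
  then show ?case by blast
next
  case (Suc m)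
  have "independent t (Suc m)" using Suc.prems(1) by (simp add: independent_def)
  then obtain r where r: "homogeneous I (Suc m) r" "\<And>j. j \<le> m \<Longrightarrow> r j \<le> t j"
    using Suc.IH Suc.prems(2,3) by auto
  have r0: "\<beta> \<le> r 0" "r 0 \<le> \<tau>" "r 0 \<notin> I"
    using independent_lower[OF homogeneousD(2)[OF r(1)]] homogeneousD(1,3)[OF r(1)] by auto
  have "\<beta> \<le> t (Suc m)" using Suc.prems(1) by (rule independent_lower) simp
  then have "linked I (r 0) (t (Suc m))" using r0 Suc.prems(2,3) by (intro linked) auto
  then obtain f s where f: "f \<le> r 0" "f \<notin> I" and s: "s \<le> t (Suc m)" and fs: "persp f s"
    unfolding linked_def by blast
  have low: "\<beta> \<le> f" "\<beta> \<le> s" using persp_lower[OF fs] by simp_all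
  obtain r' where r': "homogeneous I (Suc m) r'" "r' 0 = f" "\<And>j. j < Suc m \<Longrightarrow> r' j \<le> r j"
    using homogeneous_restrict[OF r(1) low(1) f] by blast
  have le: "r' j \<le> t j" if "j < Suc m" for j
    using order_trans[OF r'(3)[OF that] r(2)] that by simp
  have "s \<sqinter> join_upto r' (Suc m) = \<beta>"
  proof (rule disjoint_mono[OF independentD[OF Suc.prems(1) lessI] s _ low(2) join_upto_lower])
    show "join_upto r' (Suc m) \<le> join_upto t (Suc m)" using le by (rule join_upto_mono)
  qed
  moreover have "s \<le> \<tau>" using s Suc.prems(3) by (meson order_refl order_trans)
  ultimately have "homogeneous I (Suc (Suc m)) (r'(Suc m := s))"
    using r'(1,2) fs by (intro homogeneous_snoc) simp_all
  moreover have "(r'(Suc m := s)) j \<le> t j" if "j \<le> Suc m" for j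
    using that le s by (cases "j = Suc m") simp_all
  ultimately show ?case by blast
qed

text \<open>
  The rank of \<open>x\<close> modulo \<open>I\<close> is at least \<open>m\<close>. Working with the inequality avoids choosing a maximal
  sequence and any exchange argument.
\<close>
definition rank_ge :: "'a set \<Rightarrow> nat \<Rightarrow> 'a \<Rightarrow> bool" where
  "rank_ge I m x \<longleftrightarrow> (\<exists>t. independent t m \<and> (\<forall>j<m. t j \<notin> I \<and> t j \<le> x))"

lemma rank_ge_snoc:
  assumes "rank_ge I m x" and "v \<notin> I" and "v \<sqinter> x = \<beta>" and "x \<le> y" and "v \<le> y"
  shows "rank_ge I (Suc m) y"
proof -
  obtain t where t: "independent t m" "\<And>j. j < m \<Longrightarrow> t j \<notin> I" "\<And>j. j < m \<Longrightarrow> t j \<le> x"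
    using assms(1) unfolding rank_ge_def by blast
  have low: "\<beta> \<le> v" "\<beta> \<le> x" using assms(3) by (metis inf_le1 inf_le2)+
  have "join_upto t m \<le> x" using low(2) t(3) by (rule join_upto_least)
  then have "v \<sqinter> join_upto t m = \<beta>"
    using disjoint_mono[OF assms(3) order_refl _ low(1) join_upto_lower] by blast
  with t(1) have "independent (t(m := v)) (Suc m)" by (rule independent_snoc)
  moreover have "(t(m := v)) j \<notin> I \<and> (t(m := v)) j \<le> y" if "j < Suc m" for j
    using that t(2) order_trans[OF t(3) assms(4)] assms(2,5) by (cases "j = m") simp_all
  ultimately show ?thesis unfolding rank_ge_def by blast
qed

lemma rank_ge_persp:
  assumes I: "neutral_ideal I" and "persp x y" and "x \<le> \<tau>" and "rank_ge I m x"
  shows "rank_ge I m y"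
proof -
  obtain a where a: "axis a x y" using assms(2) unfolding persp_def by blast
  obtain t where t: "independent t m" "\<And>j. j < m \<Longrightarrow> t j \<notin> I" "\<And>j. j < m \<Longrightarrow> t j \<le> x"
    using assms(4) unfolding rank_ge_def by blast
  have "\<exists>f. j < m \<longrightarrow> f \<le> y \<and> axis a (t j) f" for j
    using transport[OF a independent_lower[OF t(1)] t(3)] by metis
  then obtain f where f: "\<And>j. j < m \<Longrightarrow> f j \<le> y" "\<And>j. j < m \<Longrightarrow> axis a (t j) (f j)"
    by metis
  have low: "\<beta> \<le> x" "\<beta> \<le> y" "\<beta> \<le> a" using axis_lower[OF a] by simp_all
  have le: "join_upto t j \<le> x" "join_upto f j \<le> y" if "j \<le> m" for j
    using that t(3) f(1) low by (auto intro!: join_upto_least)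
  have joins: "axis a (join_upto t j) (join_upto f j)" if j: "j \<le> m" for j
  proof -
    have "join_upto t i \<squnion> a = join_upto f i \<squnion> a" if "i \<le> m" for i
      using that
    proof (induction i)
      case (Suc i)
      then have "join_upto t i \<squnion> a = join_upto f i \<squnion> a" "t i \<squnion> a = f i \<squnion> a"
        using f(2)[of i] by (simp_all add: axis_def)
      moreover have "join_upto s (Suc i) \<squnion> a = (join_upto s i \<squnion> a) \<squnion> (s i \<squnion> a)" for s
        by (simp add: ac_simps)
      ultimately show ?case by simp
    qed simp
    moreover have "join_upto t j \<sqinter> a = \<beta>"
      using disjoint_mono[OF _ le(1)[OF j] order_refl join_upto_lower low(3)] a by (simp add: axis_def)
    moreover have "join_upto f j \<sqinter> a = \<beta>"
      using disjoint_mono[OF _ le(2)[OF j] order_refl join_upto_lower low(3)] a by (simp add: axis_def)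
    ultimately show ?thesis using j by (simp add: axis_def)
  qed
  have "f j \<sqinter> join_upto f j = \<beta>" if j: "j < m" for j
    using transport_disjoint[OF a t(3)[OF j] le(1) independentD[OF t(1) j] f(2)[OF j] joins f(1)[OF j] le(2)] j
    by simp
  then have "independent f m" by (simp add: independent_def)
  moreover have "f j \<notin> I" if j: "j < m" for j
    using persp_not_in[OF I axis_persp[OF f(2)[OF j]] t(2)[OF j]] order_trans[OF t(3)[OF j] assms(3)] by simp
  ultimately show ?thesis using f(1) unfolding rank_ge_def by blast
qed

text \<open>
  Replacing \<open>t j\<close> by \<open>t j \<sqinter> x\<close> loses only elements of \<open>I\<close>, so the members stay outside \<open>I\<close>.
\<close>
lemma rank_ge_remainder:
  assumes I: "neutral_ideal I" and "\<beta> \<le> x" and "u \<in> I" and "y \<le> x \<squnion> u" and "y \<le> \<tau>" and "rank_ge I m y"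
  shows "rank_ge I m x"
proof -
  obtain t where t: "independent t m" "\<And>j. j < m \<Longrightarrow> t j \<notin> I" "\<And>j. j < m \<Longrightarrow> t j \<le> y"
    using assms(6) unfolding rank_ge_def by blast
  have "t j \<sqinter> x \<notin> I" if j: "j < m" for j
  proof
    assume tx: "t j \<sqinter> x \<in> I"
    obtain t' where t': "t' \<le> t j" "\<beta> \<le> t'" "t' \<sqinter> x = \<beta>" "(t j \<sqinter> x) \<squnion> t' = t j"
      using independent_lower[OF t(1) j] assms(2) by (rule split_by)
    have "t' \<le> y" using t'(1) t(3)[OF j] by (rule order_trans)
    then have "t' \<in> I"
      using assms(4,5) by (intro neutral_remainder[OF I assms(3) _ _ t'(3)]) (auto intro: order_trans)
    then show False using neutral_join[OF I tx] t'(4) t(2)[OF j] by metis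
  qed
  moreover have "independent (\<lambda>j. t j \<sqinter> x) m"
    using t(1) by (rule independent_mono) (simp_all add: independent_lower[OF t(1)] assms(2))
  ultimately show ?thesis unfolding rank_ge_def by (meson inf_le2)
qed

lemma last_index:
  fixes P :: "nat \<Rightarrow> bool"
  assumes "P a" and "\<not> P b" and "a \<le> b"
  obtains m where "a \<le> m" and "P m" and "\<not> P (Suc m)"
proof -
  have "\<exists>m\<ge>a. P m \<and> \<not> P (Suc m)"
  proof (rule ccontr)
    assume *: "\<not> ?thesis"
    have "P b" using assms(3,1) by (induction rule: dec_induct) (use * in auto)
    then show False using assms(2) by simp
  qed
  then show ?thesis using that by blast
qed

text \<open>
  All of \<open>a\<close>, \<open>b\<close>, \<open>c\<close> have the same finite rank, and up to \<open>I\<close> the rank of \<open>a\<close> is that of \<open>g \<squnion> p\<close>, hence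
  that of \<open>g \<squnion> q\<close>. If \<open>v\<close> were outside \<open>I\<close>, it would make the rank of \<open>c\<close> larger than that.
\<close>
lemma rank_cancel:
  assumes I: "neutral_ideal I" and bound: "\<And>x. x \<le> \<tau> \<Longrightarrow> \<not> rank_ge I N x"
    and "a \<le> \<tau>" and "b \<le> \<tau>" and "c \<le> \<tau>" and ab: "persp a b" and bc: "persp b c"
    and "g \<sqinter> (p \<squnion> q) = \<beta>" and pq: "persp p q" and "a \<le> g \<squnion> p \<squnion> u" and "u \<in> I"
    and "g \<squnion> p \<le> a" and "g \<squnion> q \<le> c" and "v \<le> c" and "v \<sqinter> (g \<squnion> q) = \<beta>"
  shows "v \<in> I"
proof (rule ccontr)
  assume v: "v \<notin> I"
  have g: "\<beta> \<le> g" using assms(8) by (metis inf_le1)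
  have "rank_ge I 0 a" by (simp add: rank_ge_def independent_def)
  then obtain m where m: "rank_ge I m a" "\<not> rank_ge I (Suc m) a"
    using last_index[of "\<lambda>m. rank_ge I m a" 0 N] bound[OF assms(3)] by blast
  have "rank_ge I m (g \<squnion> p)"
    using rank_ge_remainder[OF I _ assms(11,10,3) m(1)] g by (simp add: le_supI1)
  moreover have "persp (g \<squnion> p) (g \<squnion> q)"
    using persp_join[OF assms(8) persp_refl[OF g] order_refl order_refl pq] by simp
  moreover have "g \<squnion> p \<le> \<tau>" using assms(12,3) by (rule order_trans)
  ultimately have "rank_ge I m (g \<squnion> q)" using rank_ge_persp[OF I] by blast
  then have "rank_ge I (Suc m) c" using v assms(15,13,14) by (rule rank_ge_snoc)
  then have "rank_ge I (Suc m) a"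
    using rank_ge_persp[OF I persp_sym[OF bc] assms(5)] rank_ge_persp[OF I persp_sym[OF ab] assms(4)] by blast
  then show False using m(2) by blast
qed

section \<open>Transitivity when homogeneous sequences are bounded\<close>

lemma neutral_ideal_bot: "neutral_ideal {\<beta>}"
proof -
  have "y = \<beta>" if y: "persp \<beta> y" for y
  proof -
    obtain x where x: "axis x \<beta> y" using y unfolding persp_def by blast
    then have "\<beta> \<squnion> x = x" using axis_lower[OF x] by (simp add: sup_absorb2)
    then have "y \<le> x" using x unfolding axis_def by (metis sup_ge1)
    then show ?thesis using x by (simp add: axis_def inf_absorb1)
  qed
  moreover have "y = \<beta>" if "\<beta> \<le> y" "y \<le> \<beta>" for y
    using that(2,1) by (rule order.antisym)
  ultimately show ?thesis
    using bounds unfolding neutral_ideal_def by simp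
qed

lemma neutral_ideal_Union_chain:
  assumes "\<C> \<noteq> {}" and "\<And>I. I \<in> \<C> \<Longrightarrow> neutral_ideal I"
    and chain: "\<And>I J. I \<in> \<C> \<Longrightarrow> J \<in> \<C> \<Longrightarrow> I \<subseteq> J \<or> J \<subseteq> I"
  shows "neutral_ideal (\<Union>\<C>)"
  unfolding neutral_ideal_def
proof (intro conjI ballI allI impI)
  show "\<Union>\<C> \<subseteq> {\<beta>..\<tau>}" using neutral_bounds assms(2) by fastforce
  show "\<beta> \<in> \<Union>\<C>" using assms(1) neutral_bot assms(2) by blast
  show "y \<in> \<Union>\<C>" if "x \<in> \<Union>\<C>" "\<beta> \<le> y" "y \<le> x" for x y
    using that(1) neutral_down[OF assms(2) _ that(2,3)] by blast
  show "x \<squnion> y \<in> \<Union>\<C>" if xy: "x \<in> \<Union>\<C>" "y \<in> \<Union>\<C>" for x y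
  proof -
    obtain K where K: "K \<in> \<C>" "x \<in> K" "y \<in> K" using xy chain by (meson UnionE subsetD)
    then show ?thesis using neutral_join[OF assms(2)[OF K(1)]] by blast
  qed
  show "y \<in> \<Union>\<C>" if "x \<in> \<Union>\<C>" "persp x y" "y \<le> \<tau>" for x y
    using that(1) neutral_persp[OF assms(2) _ that(2,3)] by blast
qed

lemma maximal_without_persp:
  assumes "\<not> persp a c"
  obtains I where "neutral_ideal I" and "\<not> persp_mod I a c"
    and "\<forall>J. neutral_ideal J \<longrightarrow> I \<subseteq> J \<longrightarrow> \<not> persp_mod J a c \<longrightarrow> J = I"
proof -
  let ?A = "{I. neutral_ideal I \<and> \<not> persp_mod I a c}"
  have "\<not> persp_mod {\<beta>} a c"
  proof
    assume "persp_mod {\<beta>} a c"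
    then obtain p q where "p \<le> a" "q \<le> c" "persp p q" "a \<le> p \<squnion> \<beta>" "c \<le> q \<squnion> \<beta>"
      unfolding persp_mod_def by blast
    moreover from this have "p \<squnion> \<beta> = p" "q \<squnion> \<beta> = q" using persp_lower sup_absorb1 by blast+
    ultimately show False using assms by (metis order.antisym)
  qed
  then have "?A \<noteq> {}" using neutral_ideal_bot by blast
  moreover have "\<Union>\<C> \<in> ?A" if C: "\<C> \<noteq> {}" "subset.chain ?A \<C>" for \<C>
  proof -
    have lin: "I \<subseteq> J \<or> J \<subseteq> I" if "I \<in> \<C>" "J \<in> \<C>" for I J
      using C(2) that unfolding subset.chain_def by blast
    have sub: "neutral_ideal I \<and> \<not> persp_mod I a c" if "I \<in> \<C>" for I
      using C(2) that unfolding subset.chain_def by blast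
    have "neutral_ideal (\<Union>\<C>)"
      using C(1) sub lin by (intro neutral_ideal_Union_chain) blast+
    moreover have "\<not> persp_mod (\<Union>\<C>) a c"
    proof
      assume "persp_mod (\<Union>\<C>) a c"
      then obtain p q u v I J where *: "p \<le> a" "q \<le> c" "persp p q"
        "I \<in> \<C>" "u \<in> I" "a \<le> p \<squnion> u" "J \<in> \<C>" "v \<in> J" "c \<le> q \<squnion> v"
        unfolding persp_mod_def by blast
      then obtain K where "K \<in> \<C>" "u \<in> K" "v \<in> K" using lin[of I J] by blast
      then show False using * sub[of K] unfolding persp_mod_def by blast
    qed
    ultimately show ?thesis by simp
  qed
  ultimately obtain I where "I \<in> ?A" "\<forall>J\<in>?A. I \<subseteq> J \<longrightarrow> J = I"
    using subset_Zorn_nonempty[of ?A] by blast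
  then show ?thesis using that by blast
qed

lemma maximal_without_persp_indecomposable:
  assumes I: "neutral_ideal I" and "a \<le> \<tau>" and "c \<le> \<tau>" and "\<not> persp_mod I a c"
    and max: "\<forall>J. neutral_ideal J \<longrightarrow> I \<subseteq> J \<longrightarrow> \<not> persp_mod J a c \<longrightarrow> J = I"
  shows "indecomposable_mod I"
  unfolding indecomposable_mod_def
proof (intro allI impI)
  fix e f assume e: "central_mod I e" and ef: "e \<sqinter> f = \<beta>" "e \<squnion> f = \<tau>"
  have f: "central_mod I f" using I e ef by (rule central_mod_complement)
  have grow: "persp_mod (adjoin d I) a c" if d: "central_mod I d" "d \<notin> I" for d
  proof (rule ccontr)
    assume "\<not> persp_mod (adjoin d I) a c"
    then have "adjoin d I = I"
      using max neutral_ideal_adjoin[OF I d(1)] adjoin_superset[OF I] by blast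
    moreover have "d \<in> adjoin d I"
      using d(1) generator_in_adjoin[OF I] unfolding central_mod_def by blast
    ultimately show False using d(2) by simp
  qed
  show "e \<in> I \<or> f \<in> I"
    using persp_mod_glue[OF I e ef assms(2,3)] grow e f assms(4) by blast
qed

lemma persp_trans:
  assumes index: "\<And>e. \<not> homogeneous {\<beta>} (Suc n) e"
    and a: "a \<le> \<tau>" and b: "b \<le> \<tau>" and c: "c \<le> \<tau>" and ab: "persp a b" and bc: "persp b c"
  shows "persp a c"
proof (rule ccontr)
  assume ac: "\<not> persp a c"
  have low: "\<beta> \<le> a" "\<beta> \<le> c" using persp_lower[OF ab] persp_lower[OF bc] by auto
  define g where "g = a \<sqinter> c"
  have g: "\<beta> \<le> g" using low by (simp add: g_def)
  obtain A where A: "A \<le> a" "\<beta> \<le> A" "A \<sqinter> g = \<beta>" "(a \<sqinter> g) \<squnion> A = a"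
    using low(1) g by (rule split_by)
  obtain C where C: "C \<le> c" "\<beta> \<le> C" "C \<sqinter> g = \<beta>" "(c \<sqinter> g) \<squnion> C = c"
    using low(2) g by (rule split_by)
  have gA: "g \<squnion> A = a" and gC: "g \<squnion> C = c" using A(4) C(4) by (simp_all add: g_def inf_left_commute inf_absorb2)
  have \<tau>: "A \<le> \<tau>" "C \<le> \<tau>" using A(1) a C(1) c by auto
  have Ca: "C \<sqinter> a = \<beta>"
  proof -
    have "C \<sqinter> a \<le> C \<sqinter> g" using C(1) by (simp add: g_def le_infI1)
    then show ?thesis using C(2,3) low by (intro order.antisym) simp_all
  qed
  have gAC: "g \<sqinter> (A \<squnion> C) = \<beta>"
    using disjoint_rotate[of g A C] A(3) Ca gA by (simp add: inf_commute)
  have AC: "A \<sqinter> C = \<beta>" using disjoint_mono[OF Ca order_refl A(1) C(2) A(2)] by (simp add: inf_commute)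
  have "\<not> persp A C"
    using persp_join[OF gAC persp_refl[OF g] order_refl order_refl, of A C] ac by (auto simp: gA gC)
  then obtain I where I: "neutral_ideal I" "\<not> persp_mod I A C"
    and max: "\<forall>J. neutral_ideal J \<longrightarrow> I \<subseteq> J \<longrightarrow> \<not> persp_mod J A C \<longrightarrow> J = I"
    by (rule maximal_without_persp)
  have ind: "indecomposable_mod I"
    using I(1) \<tau> I(2) max by (rule maximal_without_persp_indecomposable)
  have "\<tau> \<notin> I"
  proof
    assume "\<tau> \<in> I"
    moreover have "A \<le> \<beta> \<squnion> \<tau>" "C \<le> \<beta> \<squnion> \<tau>" using \<tau> by (auto intro: le_supI2)
    ultimately have "persp_mod I A C"
      using A(2) C(2) persp_refl[OF order_refl] unfolding persp_mod_def by blast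
    then show False using I(2) by simp
  qed
  then have one: "\<exists>e. homogeneous I 1 e"
    using bounds persp_refl[OF bounds]
    by (intro exI[of _ "\<lambda>_. \<tau>"]) (simp add: homogeneous_def independent_def inf_absorb2)
  have "\<not> homogeneous I (Suc n) e" for e
  proof
    assume "homogeneous I (Suc n) e"
    moreover from this have "e 0 \<noteq> \<beta>" using homogeneousD(1) neutral_bot[OF I(1)] by metis
    ultimately have "homogeneous {\<beta>} (Suc n) e" by (simp add: homogeneous_def)
    with index show False by blast
  qed
  then have none: "\<not> (\<exists>e. homogeneous I (Suc n) e)" by blast
  obtain k where k: "1 \<le> k" "\<exists>e. homogeneous I k e" "\<not> (\<exists>e. homogeneous I (Suc k) e)"
    by (rule last_index[of "\<lambda>k. \<exists>e. homogeneous I k e", OF one none]) simp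
  then obtain e where e: "homogeneous I k e" "0 < k" by auto
  have kmax: "\<not> homogeneous I (Suc k) e" for e using k(3) by blast
  have linked: "linked I x y"
    if "\<beta> \<le> x" "x \<le> \<tau>" "x \<notin> I" "\<beta> \<le> y" "y \<le> \<tau>" "y \<notin> I" for x y
    using all_linked[OF I(1) ind e kmax that] .
  have bound: "\<not> rank_ge I (Suc k) x" if x: "x \<le> \<tau>" for x
  proof
    assume "rank_ge I (Suc k) x"
    then obtain t where t: "independent t (Suc k)" "\<And>j. j < Suc k \<Longrightarrow> t j \<notin> I \<and> t j \<le> x"
      unfolding rank_ge_def by blast
    then have "\<exists>r. homogeneous I (Suc k) r \<and> (\<forall>j\<le>k. r j \<le> t j)"
      using order_trans[OF _ x] by (intro homogeneous_from_independent[OF I(1) linked]) simp_all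
    then show False using k(3) by blast
  qed
  \<comment> \<open>A pairing of perspective parts of \<open>A\<close> and \<open>C\<close> that cannot be prolonged is one whose rank
    reaches \<open>m\<close> while no pairing has a rank of at least \<open>m + 1\<close>.\<close>
  define pairs where "pairs m \<longleftrightarrow> (\<exists>p q. p \<le> A \<and> q \<le> C \<and> persp p q \<and> rank_ge I m p)" for m
  have "pairs 0"
    using A(2) C(2) persp_refl[OF order_refl] unfolding pairs_def
    by (intro exI[of _ \<beta>]) (simp add: rank_ge_def independent_def)
  moreover have "\<not> pairs (Suc k)" using bound order_trans[OF _ \<tau>(1)] unfolding pairs_def by blast
  ultimately obtain m where m: "pairs m" "\<not> pairs (Suc m)"
    using last_index[of pairs 0 "Suc k"] by blast
  then obtain p q where pq: "p \<le> A" "q \<le> C" "persp p q" "rank_ge I m p"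
    unfolding pairs_def by blast
  have bpq: "\<beta> \<le> p" "\<beta> \<le> q" using persp_lower[OF pq(3)] by auto
  obtain u where u: "u \<le> A" "\<beta> \<le> u" "u \<sqinter> p = \<beta>" "(A \<sqinter> p) \<squnion> u = A"
    using A(2) bpq(1) by (rule split_by)
  obtain v where v: "v \<le> C" "\<beta> \<le> v" "v \<sqinter> q = \<beta>" "(C \<sqinter> q) \<squnion> v = C"
    using C(2) bpq(2) by (rule split_by)
  have A_eq: "A = p \<squnion> u" and C_eq: "C = q \<squnion> v"
    using u(4) v(4) pq(1,2) by (simp_all add: inf_absorb2)
  have gpq: "g \<sqinter> (p \<squnion> q) = \<beta>"
    using disjoint_mono[OF gAC order_refl sup_mono[OF pq(1,2)] g] bpq by (simp add: le_supI1)
  then have gqp: "g \<sqinter> (q \<squnion> p) = \<beta>" by (simp add: sup_commute)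
  have v_gq: "v \<sqinter> (g \<squnion> q) = \<beta>"
    using disjoint_rotate[OF v(3), of g] C(3) C_eq by (simp add: sup_commute inf_commute)
  have u_gp: "u \<sqinter> (g \<squnion> p) = \<beta>"
    using disjoint_rotate[OF u(3), of g] A(3) A_eq by (simp add: sup_commute inf_commute)
  have uv: "u \<in> I \<or> v \<in> I"
  proof (rule ccontr)
    assume "\<not> ?thesis"
    then have "linked I u v" using u(1,2) v(1,2) \<tau> by (intro linked) auto
    then obtain u' v' where uv': "u' \<le> u" "v' \<le> v" "u' \<notin> I" "persp u' v'"
      unfolding linked_def by blast
    have disj: "(p \<squnion> q) \<sqinter> (u \<squnion> v) = \<beta>"
      using AC pq(1,2) u v by (intro disjoint_joins[of A C]) (auto simp: inf_commute)
    have "persp (p \<squnion> u') (q \<squnion> v')"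
      using uv' by (intro persp_join[OF disj pq(3)]) (simp_all add: le_supI1 le_supI2)
    moreover have "p \<squnion> u' \<le> A" "q \<squnion> v' \<le> C"
      using pq(1,2) uv'(1,2) u(1) v(1) by auto
    moreover have "u' \<sqinter> p = \<beta>"
      using disjoint_mono[OF u(3) uv'(1) order_refl] persp_lower[OF uv'(4)] bpq by simp
    then have "rank_ge I (Suc m) (p \<squnion> u')"
      using pq(4) uv'(3) by (intro rank_ge_snoc[of I m p u']) auto
    ultimately have "pairs (Suc m)" unfolding pairs_def by blast
    then show False using m(2) by simp
  qed
  have gle: "g \<squnion> p \<le> a" "g \<squnion> q \<le> c" "u \<le> a" "v \<le> c"
    using pq(1,2) u(1) v(1) by (auto simp: gA[symmetric] gC[symmetric] intro: le_supI2)
  have "a \<le> g \<squnion> p \<squnion> u" "c \<le> g \<squnion> q \<squnion> v"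
    using gA gC A_eq C_eq by (simp_all add: sup_assoc)
  then have "u \<in> I" "v \<in> I"
    using uv
      rank_cancel[OF I(1) bound a b c ab bc gpq pq(3) _ _ gle(1,2,4) v_gq]
      rank_cancel[OF I(1) bound c b a persp_sym[OF bc] persp_sym[OF ab] gqp persp_sym[OF pq(3)] _ _ gle(2,1,3) u_gp]
    by blast+
  then have "persp_mod I A C"
    using pq(1-3) A_eq C_eq unfolding persp_mod_def by blast
  then show False using I(2) by simp
qed

section \<open>Finite distributivity bounds homogeneous sequences\<close>

text \<open>
  The ``coordinate hyperplanes'', i.e. the joins of all but one member, of an independent sequence
  meet in \<open>\<beta>\<close>. Replacing a member by \<open>\<beta>\<close> is a way to omit it without reindexing.
\<close>
lemma join_upto_omit_bot:
  assumes "independent e m"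
  shows "(\<forall>i<m. w \<le> join_upto (e(i := \<beta>)) m) \<Longrightarrow> w \<le> join_upto e m \<Longrightarrow> w \<le> \<beta>"
  using assms
proof (induction m)
  case 0
  then show ?case by simp
next
  case (Suc m)
  have ind: "independent e m" using Suc.prems(3) by (simp add: independent_def)
  have "join_upto (e(m := \<beta>)) m = join_upto e m" by (rule join_upto_cong) simp
  then have wm: "w \<le> join_upto e m"
    using Suc.prems(1)[rule_format, of m] join_upto_lower by (simp add: sup_absorb1)
  moreover have "w \<le> join_upto (e(i := \<beta>)) m" if i: "i < m" for i
  proof -
    have "join_upto (e(i := \<beta>)) m \<le> join_upto e m"
      using independent_lower[OF ind i] by (intro join_upto_mono) simp
    moreover have "e m \<sqinter> join_upto e m \<le> join_upto (e(i := \<beta>)) m"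
      using independentD[OF Suc.prems(3), of m] join_upto_lower by simp
    ultimately have "join_upto e m \<sqinter> (join_upto (e(i := \<beta>)) m \<squnion> e m) = join_upto (e(i := \<beta>)) m"
      by (rule meet_join_absorb)
    moreover have "w \<le> join_upto (e(i := \<beta>)) m \<squnion> e m"
      using Suc.prems(1)[rule_format, of i] i by simp
    ultimately show ?thesis using wm by (metis le_inf_iff)
  qed
  ultimately show ?case using Suc.IH ind by blast
qed

text \<open>
  In coordinates the axis \<open>x j\<close> is spanned by the difference of the basis vectors \<open>0\<close> and \<open>j\<close>, so the join
  of the axes is the hyperplane where all coordinates sum to zero; it contains no basis vector.
\<close>
lemma axes_avoid_first:
  assumes e: "independent e (Suc m)"
    and x: "\<And>j. 0 < j \<Longrightarrow> j \<le> m \<Longrightarrow> axis (x j) (e 0) (e j) \<and> x j \<le> e 0 \<squnion> e j" and "x 0 = \<beta>"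
  shows "join_upto x (Suc m) \<sqinter> e 0 = \<beta> \<and> join_upto x (Suc m) \<le> join_upto e (Suc m)"
  using e x
proof (induction m)
  case 0
  have "\<beta> \<le> e 0" using 0(1) by (rule independent_lower) simp
  then show ?case using assms(3) by (simp add: inf_absorb1 sup_absorb2)
next
  case (Suc m)
  let ?X = "join_upto x (Suc m)" and ?E = "join_upto e (Suc m)"
  have "independent e (Suc m)" using Suc.prems(1) by (simp add: independent_def)
  then have IH: "?X \<sqinter> e 0 = \<beta>" "?X \<le> ?E" using Suc.IH Suc.prems(2) by auto
  have ax: "axis (x (Suc m)) (e 0) (e (Suc m))" "x (Suc m) \<le> e 0 \<squnion> e (Suc m)"
    using Suc.prems(2)[of "Suc m"] by auto
  have e0E: "e 0 \<le> ?E" by (rule join_upto_upper) simp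
  have low: "\<beta> \<le> e 0" using axis_lower[OF ax(1)] by simp
  have "e (Suc m) \<sqinter> ?E \<le> e 0" using independentD[OF Suc.prems(1), of "Suc m"] low by simp
  with e0E have "?E \<sqinter> (e 0 \<squnion> e (Suc m)) = e 0" by (rule meet_join_absorb)
  then have "x (Suc m) \<sqinter> ?E \<le> e 0"
    using ax(2) by (metis inf_commute inf_mono order_refl)
  then have "x (Suc m) \<sqinter> ?E \<le> e 0 \<sqinter> x (Suc m)" by simp
  then have "x (Suc m) \<sqinter> ?E \<le> ?X" using ax(1) join_upto_lower[of x "Suc m"] unfolding axis_def by simp
  with IH(2) have "?E \<sqinter> (?X \<squnion> x (Suc m)) = ?X" by (rule meet_join_absorb)
  then have "e 0 \<sqinter> (?X \<squnion> x (Suc m)) = e 0 \<sqinter> ?X"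
    using e0E by (metis inf_absorb1 inf_assoc)
  moreover have "e 0 \<squnion> e (Suc m) \<le> ?E \<squnion> e (Suc m)" using e0E by (rule sup_mono) simp
  then have "?X \<squnion> x (Suc m) \<le> ?E \<squnion> e (Suc m)"
    using order_trans[OF ax(2)] IH(2) by (simp add: le_supI1 del: join_upto.simps)
  ultimately show ?case
    using IH(1) unfolding join_upto.simps(2)[of _ "Suc m"] by (metis inf_commute)
qed

text \<open>
  The identity is applied to the hyperplane \<open>X\<close> in general position and the coordinate hyperplanes
  \<open>y i\<close>. The \<open>y i\<close> meet in \<open>\<beta>\<close>, so the left-hand side is \<open>X\<close>. All \<open>y j\<close> with \<open>j \<noteq> i\<close> lie above \<open>e i\<close>, and
  \<open>X \<squnion> e i\<close> contains \<open>e 0\<close> because \<open>X\<close> contains the axis \<open>x i\<close>; so the right-hand side is above \<open>e 0\<close>,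
  although \<open>X\<close> is disjoint from \<open>e 0\<close>.
\<close>
lemma n_distributive_no_homogeneous:
  assumes n: "0 < n" and dist: "n_distributive_on n {\<beta>..\<tau>}"
  shows "\<not> homogeneous {\<beta>} (Suc n) e"
proof
  assume e: "homogeneous {\<beta>} (Suc n) e"
  let ?E = "join_upto e (Suc n)"
  have ind: "independent e (Suc n)" using e by (rule homogeneousD)
  have "\<exists>y. (0 < j \<and> j \<le> n \<longrightarrow> axis y (e 0) (e j) \<and> y \<le> e 0 \<squnion> e j) \<and> (j = 0 \<longrightarrow> y = \<beta>)" for j
  proof (cases "0 < j \<and> j \<le> n")
    case True
    then have "persp (e 0) (e j)" using homogeneousD(4)[OF e, of j] by simp
    then show ?thesis using persp_axis_below True by (metis less_irrefl)
  qed auto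
  then obtain x where x: "\<And>j. 0 < j \<Longrightarrow> j \<le> n \<Longrightarrow> axis (x j) (e 0) (e j) \<and> x j \<le> e 0 \<squnion> e j" "x 0 = \<beta>"
    by metis
  define X where "X = join_upto x (Suc n)"
  have X: "X \<sqinter> e 0 = \<beta>" "X \<le> ?E"
    using axes_avoid_first[OF ind x] by (simp_all add: X_def)
  define y where "y i = join_upto (e(i := \<beta>)) (Suc n)" for i
  have E\<tau>: "?E \<le> \<tau>" using e by (rule homogeneous_join_le)
  have yE: "y i \<le> ?E" if "i \<le> n" for i
    unfolding y_def using independent_lower[OF ind] by (intro join_upto_mono) auto
  have "X \<in> {\<beta>..\<tau>}"
    using join_upto_lower[of x "Suc n"] order_trans[OF X(2) E\<tau>] unfolding X_def by simp
  moreover have "\<forall>i\<le>n. y i \<in> {\<beta>..\<tau>}"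
    using order_trans[OF yE E\<tau>] join_upto_lower unfolding y_def atLeastAtMost_iff by blast
  ultimately have id: "X \<squnion> Inf_fin (y ` {..n}) = Inf_fin ((\<lambda>i. X \<squnion> Inf_fin (y ` ({..n} - {i}))) ` {..n})"
    using dist unfolding n_distributive_on_def by blast
  have "Inf_fin (y ` {..n}) \<le> \<beta>"
  proof (rule join_upto_omit_bot[OF ind])
    have inf: "Inf_fin (y ` {..n}) \<le> y i" if "i \<le> n" for i
      using that by (intro Inf_fin.coboundedI) auto
    then show "\<forall>i<Suc n. Inf_fin (y ` {..n}) \<le> join_upto (e(i := \<beta>)) (Suc n)"
      by (simp add: y_def)
    show "Inf_fin (y ` {..n}) \<le> ?E" using inf[of 0] yE[of 0] by simp
  qed
  then have "X \<squnion> Inf_fin (y ` {..n}) \<le> X"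
    using join_upto_lower order_trans unfolding X_def by (metis le_supI order_refl)
  moreover have "e 0 \<le> Inf_fin ((\<lambda>i. X \<squnion> Inf_fin (y ` ({..n} - {i}))) ` {..n})"
  proof (rule Inf_fin.boundedI)
    fix w assume "w \<in> (\<lambda>i. X \<squnion> Inf_fin (y ` ({..n} - {i}))) ` {..n}"
    then obtain i where i: "i \<le> n" "w = X \<squnion> Inf_fin (y ` ({..n} - {i}))" by auto
    have "(if i = 0 then 1 else 0) \<in> {..n} - {i}" using n by auto
    then have "{..n} - {i} \<noteq> {}" by blast
    then have "e i \<le> Inf_fin (y ` ({..n} - {i}))"
    proof (intro Inf_fin.boundedI)
      fix w' assume "w' \<in> y ` ({..n} - {i})"
      then obtain j where "j \<noteq> i" "w' = y j" by blast
      then show "e i \<le> w'"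
        using join_upto_upper[of i "Suc n" "e(j := \<beta>)"] i(1) by (simp add: y_def del: join_upto.simps)
    qed simp_all
    then have ei: "e i \<le> w" using i(2) by (simp add: le_supI2)
    show "e 0 \<le> w"
    proof (cases "i = 0")
      case True
      then show ?thesis using ei by simp
    next
      case False
      then have "axis (x i) (e 0) (e i)" using x(1) i(1) by simp
      then have "e 0 \<le> e i \<squnion> x i" unfolding axis_def by (metis sup_ge1)
      moreover have "x i \<le> X" unfolding X_def using i(1) by (intro join_upto_upper) simp
      then have "x i \<le> w" using i(2) by (simp add: le_supI1)
      ultimately show ?thesis using ei by (meson le_supI order_trans)
    qed
  qed auto
  ultimately have "e 0 \<le> X" using id by simp
  then have "e 0 = \<beta>" using X(1) by (simp add: inf_absorb2)
  then show False using homogeneousD(1)[OF e] by simp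
qed

end

theorem corollary11p15:
  assumes "modular_on (UNIV :: 'a::lattice set)"
    and "relatively_complemented TYPE('a)"
    and "locally_finitely_distributive TYPE('a)"
  shows "\<forall>a b c :: 'a. a \<sim> b \<longrightarrow> b \<sim> c \<longrightarrow> a \<sim> c"
proof (intro allI impI)
  fix a b c :: 'a
  assume "a \<sim> b" and "b \<sim> c"
  then obtain x y where x: "a \<sqinter> x = b \<sqinter> x" "a \<squnion> x = b \<squnion> x" and y: "b \<sqinter> y = c \<sqinter> y" "b \<squnion> y = c \<squnion> y"
    unfolding perspective_def by blast
  define \<beta> where "\<beta> = (a \<sqinter> x) \<sqinter> (b \<sqinter> y)"
  define \<tau> where "\<tau> = a \<squnion> b \<squnion> c"
  have bounds: "\<beta> \<le> \<tau>" by (simp add: \<beta>_def \<tau>_def le_infI1 le_supI1)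
  interpret complemented_modular_interval \<beta> \<tau>
  proof
    show "\<beta> \<le> \<tau>" by (rule bounds)
    show "u \<squnion> (v \<sqinter> w) = (u \<squnion> v) \<sqinter> w" if "u \<le> w" for u v w :: 'a
      using assms(1) that by (simp add: modular_on_def)
    show "\<exists>v. l \<le> v \<and> v \<le> h \<and> u \<sqinter> v = l \<and> u \<squnion> v = h" if "l \<le> u" "u \<le> h" for l h u :: 'a
    proof -
      have "complemented_interval l h"
        using assms(2) order_trans[OF that] by (simp add: relatively_complemented_def)
      then show ?thesis using that unfolding complemented_interval_def by (metis atLeastAtMost_iff)
    qed
  qed
  \<comment> \<open>A complement of \<open>d \<sqinter> z\<close> in \<open>z\<close> over \<open>\<beta>\<close> has the same joins with \<open>d\<close> and \<open>d'\<close> as \<open>z\<close>.\<close>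
  have persp: "persp d d'" if d: "d \<sqinter> z = d' \<sqinter> z" "d \<squnion> z = d' \<squnion> z" "\<beta> \<le> d \<sqinter> z" for d d' z
  proof -
    have "\<beta> \<le> z" "\<beta> \<le> d \<sqinter> z" using d(3) by simp_all
    then obtain z' where z': "z' \<le> z" "\<beta> \<le> z'" "z' \<sqinter> (d \<sqinter> z) = \<beta>" "(z \<sqinter> (d \<sqinter> z)) \<squnion> z' = z"
      by (rule split_by)
    have "z = (d \<sqinter> z) \<squnion> z'" using z'(4) by (simp add: inf_left_commute)
    then have sup: "d \<squnion> z' = d \<squnion> z" "d' \<squnion> z' = d' \<squnion> z"
      using d(1) by (metis sup_assoc sup_inf_absorb)+
    have "d \<sqinter> z' = \<beta>" using z'(1,3) by (metis inf_absorb1 inf_left_commute inf_commute)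
    moreover have "d' \<sqinter> z' = \<beta>" using z'(1,3) d(1) by (metis inf_absorb1 inf_left_commute inf_commute)
    ultimately have "axis z' d d'" using sup d(2) by (simp add: axis_def)
    then show ?thesis by (rule axis_persp)
  qed
  have ab: "persp a b" using x by (rule persp) (simp add: \<beta>_def le_infI1 del: le_inf_iff)
  have bc: "persp b c" using y by (rule persp) (simp add: \<beta>_def le_infI2 del: le_inf_iff)
  obtain n where n: "0 < n" "n_distributive_on n {\<beta>..\<tau>}"
    using assms(3) bounds unfolding locally_finitely_distributive_def finitely_distributive_on_def by blast
  have "persp a c"
    using n_distributive_no_homogeneous[OF n] _ _ _ ab bc
    by (rule persp_trans) (simp_all add: \<tau>_def le_supI1)
  then show "a \<sim> c"
    unfolding persp_def axis_def perspective_def by metis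
qed

end
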